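(* Let $\mathcal G$ be a class of digraphs for which there is a constant $d$ with $\Delta(G)\le d$ for all $G\in\mathcal G$. Then any two parameters in $\{\mathrm{d\text{-}nw},\mathrm{d\text{-}lnlcw},\mathrm{d\text{-}lcw},\mathrm{d\text{-}lrw}\}$ are polynomially equivalent on $\mathcal G$: for any two of them $\alpha,\beta$ there exist polynomials $f_1,f_2$ such that for every $G\in\mathcal G$, $\alpha(G)\le f_1(\beta(G))$ and $\beta(G)\le f_2(\alpha(G))$.
   Context: Digraphs $G=(V,E)$ are finite with $E\subseteq\{(u,v):u\ne v\}$; $\Delta(G)=\max_{v}(\text{outdegree}(v)+\text{indegree}(v))$. A layout is a bijection $\varphi:V\to\{1,\dots,|V|\}$; $L(i,\varphi)=\{u:\varphi(u)\le i\}$, $R(i,\varphi)=\{u:\varphi(u)>i\}$. With $N_i(u)=(\{v\in R(i,\varphi):(u,v)\in E\},\{v\in R(i,\varphi):(v,u)\in E\})$, $\mathrm{d\text{-}nw}(G)=\min_\varphi\max_i|\{N_i(u):u\in L(i,\varphi)\}|$. $\mathrm{d\text{-}lnlcw}(G)$ is the least $k$ such that $G$ (under some labeling) is built from labeled digraphs with labels in $[k]$ by: $\bullet_a$ (a vertex labeled $a$); $H\otimes_{(\overrightarrow S,\overleftarrow S)}\bullet_a$ ($\overrightarrow S,\overleftarrow S\subseteq[k]^2$): add a new vertex $v$ labeled $a$ plus arcs $(u,v)$ for $u$ in $H$ of label $b$ with $(b,a)\in\overrightarrow S$ and arcs $(v,u)$ for $u$ in $H$ of label $b$ with $(b,a)\in\overleftarrow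 S$; $\circ_R$ ($R:[k]\to[k]$, relabel $a$ to $R(a)$). $\mathrm{d\text{-}lcw}(G)$ is the least number of labels to build $G$ with $\bullet_a$, $H\oplus\bullet_a$ (add a new isolated vertex labeled $a$), $\alpha_{a,b}$ ($a\ne b$; add arcs from all label-$a$ to all label-$b$ vertices), $\rho_{a\to b}$ (relabel). $\mathrm{d\text{-}lrw}(G)$: minimum over pairs $(T,f)$, $T$ a caterpillar (a path with pendant vertices), $f$ a bijection from $V$ to the leaves of $T$, of the maximum over edges $e$ of $T$ (splitting $V$ into $A_e,B_e$) of the $GF(4)$-rank of the $A_e\times B_e$ matrix with entry $0$ (no arc between $x,y$), $\omega$ (only $(x,y)\in E$), $\omega^2$ (only $(y,x)\in E$), $1$ (both), where $GF(4)=\{0,1,\omega,\omega^2\}$.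
   Formalization: In d-lrw the caterpillar is required to have maximum degree at most 3, the usual convention for rank decompositions; if stars were allowed, d-lrw would be at most 1 for every digraph and the claim would fail, for example on directed grids. *)

theory Defs
  imports
    "Graph_Theory.Pair_Digraph"
    "HOL-Library.Function_Algebras"
    "HOL-Computational_Algebra.Polynomial"
begin

text \<open>Minima and maxima of parameters are written with \<open>Inf\<close> and \<open>Sup\<close> on \<open>nat\<close>:
  \<open>Inf\<close> is the least element of a nonempty set, \<open>Sup\<close> is the maximum of a finite set, and
  the supremum of the empty set is \<open>0\<close>.\<close>

definition max_degree :: "'a pair_pre_digraph \<Rightarrow> nat" where
  "max_degree G = (SUP v \<in> pverts G. out_degree G v + in_degree G v)"


section \<open>Directed neighbourhood-width\<close>

definition layouts :: "'a pair_pre_digraph \<Rightarrow> ('a \<Rightarrow> nat) set" where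
  "layouts G = {\<phi>. bij_betw \<phi> (pverts G) {1..card (pverts G)}}"

definition left_part :: "'a pair_pre_digraph \<Rightarrow> nat \<Rightarrow> ('a \<Rightarrow> nat) \<Rightarrow> 'a set" where
  "left_part G i \<phi> = {u \<in> pverts G. \<phi> u \<le> i}"

definition right_part :: "'a pair_pre_digraph \<Rightarrow> nat \<Rightarrow> ('a \<Rightarrow> nat) \<Rightarrow> 'a set" where
  "right_part G i \<phi> = {u \<in> pverts G. \<phi> u > i}"

definition dir_neighbourhood ::
  "'a pair_pre_digraph \<Rightarrow> ('a \<Rightarrow> nat) \<Rightarrow> nat \<Rightarrow> 'a \<Rightarrow> 'a set \<times> 'a set" where
  "dir_neighbourhood G \<phi> i u =
     ({v \<in> right_part G i \<phi>. (u, v) \<in> parcs G}, {v \<in> right_part G i \<phi>. (v, u) \<in> parcs G})"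

definition d_nw :: "'a pair_pre_digraph \<Rightarrow> nat" where
  "d_nw G = (INF \<phi> \<in> layouts G. SUP i \<in> {1..card (pverts G)}.
     card (dir_neighbourhood G \<phi> i ` left_part G i \<phi>))"


section \<open>Directed linear NLC-width\<close>

text \<open>A labeled digraph is a digraph together with a labeling function, of which only the
  values on the vertex set matter.\<close>

inductive lnlc_built :: "nat \<Rightarrow> 'a pair_pre_digraph \<Rightarrow> ('a \<Rightarrow> nat) \<Rightarrow> bool" for k :: nat where
  vertex: "a \<in> {1..k} \<Longrightarrow> lnlc_built k \<lparr>pverts = {v}, parcs = {}\<rparr> (\<lambda>_. a)"
| insert: "\<lbrakk>lnlc_built k H lab; v \<notin> pverts H; a \<in> {1..k};
     S\<^sub>f \<subseteq> {1..k} \<times> {1..k}; S\<^sub>b \<subseteq> {1..k} \<times> {1..k}\<rbrakk> \<Longrightarrow>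
   lnlc_built k
     \<lparr>pverts = insert v (pverts H),
      parcs = parcs H \<union> {(u, v) | u. u \<in> pverts H \<and> (lab u, a) \<in> S\<^sub>f}
                      \<union> {(v, u) | u. u \<in> pverts H \<and> (lab u, a) \<in> S\<^sub>b}\<rparr>
     (lab(v := a))"
| relabel: "\<lbrakk>lnlc_built k H lab; R ` {1..k} \<subseteq> {1..k}\<rbrakk> \<Longrightarrow> lnlc_built k H (R \<circ> lab)"

definition d_lnlcw :: "'a pair_pre_digraph \<Rightarrow> nat" where
  "d_lnlcw G = (LEAST k. \<exists>lab. lnlc_built k G lab)"


section \<open>Directed linear clique-width\<close>

inductive lc_built :: "nat \<Rightarrow> 'a pair_pre_digraph \<Rightarrow> ('a \<Rightarrow> nat) \<Rightarrow> bool" for k :: nat where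
  vertex: "a \<in> {1..k} \<Longrightarrow> lc_built k \<lparr>pverts = {v}, parcs = {}\<rparr> (\<lambda>_. a)"
| insert: "\<lbrakk>lc_built k H lab; v \<notin> pverts H; a \<in> {1..k}\<rbrakk> \<Longrightarrow>
   lc_built k \<lparr>pverts = insert v (pverts H), parcs = parcs H\<rparr> (lab(v := a))"
| add_arcs: "\<lbrakk>lc_built k H lab; a \<in> {1..k}; b \<in> {1..k}; a \<noteq> b\<rbrakk> \<Longrightarrow>
   lc_built k
     \<lparr>pverts = pverts H,
      parcs = parcs H \<union> {(u, v). u \<in> pverts H \<and> v \<in> pverts H \<and> lab u = a \<and> lab v = b}\<rparr>
     lab"
| relabel: "\<lbrakk>lc_built k H lab; a \<in> {1..k}; b \<in> {1..k}\<rbrakk> \<Longrightarrow>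
   lc_built k H (\<lambda>u. if lab u = a then b else lab u)"

definition d_lcw :: "'a pair_pre_digraph \<Rightarrow> nat" where
  "d_lcw G = (LEAST k. \<exists>lab. lc_built k G lab)"


section \<open>The field with four elements\<close>

datatype gf4 = GF4_0 | GF4_1 | GF4_w | GF4_w2

instantiation gf4 :: field
begin

definition zero_gf4 :: gf4 where "0 = GF4_0"
definition one_gf4 :: gf4 where "1 = GF4_1"

fun plus_gf4 :: "gf4 \<Rightarrow> gf4 \<Rightarrow> gf4" where
  "GF4_0 + y = y"
| "x + GF4_0 = x"
| "GF4_1 + GF4_1 = GF4_0"
| "GF4_1 + GF4_w = GF4_w2"
| "GF4_1 + GF4_w2 = GF4_w"
| "GF4_w + GF4_1 = GF4_w2"
| "GF4_w + GF4_w = GF4_0"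
| "GF4_w + GF4_w2 = GF4_1"
| "GF4_w2 + GF4_1 = GF4_w"
| "GF4_w2 + GF4_w = GF4_1"
| "GF4_w2 + GF4_w2 = GF4_0"

fun times_gf4 :: "gf4 \<Rightarrow> gf4 \<Rightarrow> gf4" where
  "GF4_0 * y = GF4_0"
| "x * GF4_0 = GF4_0"
| "GF4_1 * y = y"
| "x * GF4_1 = x"
| "GF4_w * GF4_w = GF4_w2"
| "GF4_w * GF4_w2 = GF4_1"
| "GF4_w2 * GF4_w = GF4_1"
| "GF4_w2 * GF4_w2 = GF4_w"

definition uminus_gf4 :: "gf4 \<Rightarrow> gf4" where "- x = x" for x :: gf4
definition minus_gf4 :: "gf4 \<Rightarrow> gf4 \<Rightarrow> gf4" where "x - y = x + y" for x y :: gf4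

definition inverse_gf4 :: "gf4 \<Rightarrow> gf4" where
  "inverse x = (case x of GF4_0 \<Rightarrow> GF4_0 | GF4_1 \<Rightarrow> GF4_1 | GF4_w \<Rightarrow> GF4_w2 | GF4_w2 \<Rightarrow> GF4_w)"
definition divide_gf4 :: "gf4 \<Rightarrow> gf4 \<Rightarrow> gf4" where "x div y = x * inverse y" for x y :: gf4

instance
proof
  fix a b c :: gf4
  show "a + b + c = a + (b + c)" by (cases a; cases b; cases c; simp)
  show "a + b = b + a" by (cases a; cases b; simp)
  show "0 + a = a" by (simp add: zero_gf4_def)
  show "- a + a = 0" by (cases a; simp add: zero_gf4_def uminus_gf4_def)
  show "a - b = a + - b" by (simp add: minus_gf4_def uminus_gf4_def)
  show "a * b * c = a * (b * c)" by (cases a; cases b; cases c; simp)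
  show "a * b = b * a" by (cases a; cases b; simp)
  show "1 * a = a" by (cases a; simp add: one_gf4_def)
  show "(a + b) * c = a * c + b * c" by (cases a; cases b; cases c; simp)
  show "(0::gf4) \<noteq> 1" by (simp add: zero_gf4_def one_gf4_def)
  show "a \<noteq> 0 \<Longrightarrow> inverse a * a = 1"
    by (cases a; simp add: zero_gf4_def one_gf4_def inverse_gf4_def)
  show "a div b = a * inverse b" by (simp add: divide_gf4_def)
  show "inverse (0::gf4) = 0" by (simp add: zero_gf4_def inverse_gf4_def)
qed

end


section \<open>Directed linear rank-width\<close>

definition fun_scale :: "'b::field \<Rightarrow> ('a \<Rightarrow> 'b) \<Rightarrow> 'a \<Rightarrow> 'b" where
  "fun_scale c f = (\<lambda>x. c * f x)"

lemma vector_space_fun_scale: "vector_space (fun_scale :: 'b::field \<Rightarrow> ('a \<Rightarrow> 'b) \<Rightarrow> 'a \<Rightarrow> 'b)"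
  by unfold_locales (auto simp: fun_scale_def fun_eq_iff algebra_simps)

text \<open>The rank of the \<open>A \<times> B\<close> matrix \<open>M\<close>, as the dimension of the span of its rows;
  a row is a function on column indices, padded with \<open>0\<close> outside \<open>B\<close>.\<close>

definition matrix_rank :: "'a set \<Rightarrow> 'b set \<Rightarrow> ('a \<Rightarrow> 'b \<Rightarrow> 'c::field) \<Rightarrow> nat" where
  "matrix_rank A B M =
     vector_space.dim fun_scale ((\<lambda>x y. if y \<in> B then M x y else 0) ` A)"

definition adj_gf4 :: "'a pair_pre_digraph \<Rightarrow> 'a \<Rightarrow> 'a \<Rightarrow> gf4" where
  "adj_gf4 G x y =
     (if (x, y) \<in> parcs G
      then (if (y, x) \<in> parcs G then GF4_1 else GF4_w)
      else (if (y, x) \<in> parcs G then GF4_w2 else GF4_0))"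

text \<open>Trees are undirected graphs, represented as symmetric digraphs, so \<open>out_degree\<close> is the
  degree. A caterpillar consists of a path \<open>ps\<close> and pendant vertices \<open>q\<close>, each attached to a
  vertex \<open>h q\<close> of the path.\<close>

definition caterpillar :: "'v pair_pre_digraph \<Rightarrow> bool" where
  "caterpillar T \<longleftrightarrow> finite (pverts T) \<and>
     (\<exists>ps h. ps \<noteq> [] \<and> distinct ps \<and> set ps \<subseteq> pverts T \<and>
        h ` (pverts T - set ps) \<subseteq> set ps \<and>
        (let D = set (zip ps (tl ps)) \<union> {(q, h q) | q. q \<in> pverts T - set ps}
         in parcs T = D \<union> D\<inverse>))"

text \<open>The bound \<open>1\<close> rather than equality makes the vertex of the one-vertex tree a leaf.\<close>

definition leaves :: "'v pair_pre_digraph \<Rightarrow> 'v set" where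
  "leaves T = {t \<in> pverts T. out_degree T t \<le> 1}"

text \<open>As always for rank-decompositions, the tree has maximum degree at most three (otherwise a
  star would be a decomposition of width at most one of every digraph).\<close>

definition linear_rank_decomposition ::
  "'a pair_pre_digraph \<Rightarrow> 'v pair_pre_digraph \<Rightarrow> ('a \<Rightarrow> 'v) \<Rightarrow> bool" where
  "linear_rank_decomposition G T f \<longleftrightarrow>
     caterpillar T \<and> (\<forall>t \<in> pverts T. out_degree T t \<le> 3) \<and> bij_betw f (pverts G) (leaves T)"

definition del_edge :: "'v pair_pre_digraph \<Rightarrow> 'v \<Rightarrow> 'v \<Rightarrow> 'v pair_pre_digraph" where
  "del_edge T s t = T\<lparr>parcs := parcs T - {(s, t), (t, s)}\<rparr>"

definition edge_side ::
  "'a pair_pre_digraph \<Rightarrow> 'v pair_pre_digraph \<Rightarrow> ('a \<Rightarrow> 'v) \<Rightarrow> 'v \<Rightarrow> 'v \<Rightarrow> 'a set" where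
  "edge_side G T f s t = {x \<in> pverts G. s \<rightarrow>\<^sup>*\<^bsub>with_proj (del_edge T s t)\<^esub> f x}"

text \<open>Each edge of \<open>T\<close> occurs in both orientations; these give the matrices on
  \<open>A\<^sub>e \<times> B\<^sub>e\<close> and on \<open>B\<^sub>e \<times> A\<^sub>e\<close>, which have the same rank since exchanging \<open>\<omega>\<close> and
  \<open>\<omega>\<^sup>2\<close> is an automorphism of the field.\<close>

definition decomposition_width ::
  "'a pair_pre_digraph \<Rightarrow> 'v pair_pre_digraph \<Rightarrow> ('a \<Rightarrow> 'v) \<Rightarrow> nat" where
  "decomposition_width G T f =
     (SUP (s, t) \<in> parcs T. matrix_rank (edge_side G T f s t) (edge_side G T f t s) (adj_gf4 G))"

text \<open>Every finite tree is isomorphic to one on natural numbers.\<close>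

definition d_lrw :: "'a pair_pre_digraph \<Rightarrow> nat" where
  "d_lrw G = (INF (T, f) \<in> {(T :: nat pair_pre_digraph, f). linear_rank_decomposition G T f}.
     decomposition_width G T f)"

end

theory Submission
  imports Defs
begin

text \<open>Every parameter is compared with neighbourhood-width, and all bounds are linear. In a linear
  construction with \<open>k\<close> labels, vertices of equal label are not distinguished by vertices added
  later, so the order of insertion is a layout of width at most \<open>k\<close>; conversely, the classes of
  vertices with equal neighbourhoods to the right serve as labels, with one extra label for the
  next vertex. The cut-rank is at most the number of distinct rows or columns. For the converse,
  if degrees are at most \<open>d\<close> and the rank is \<open>r\<close>, then \<open>r\<close> basis rows cover the at most \<open>r d\<close>
  nonzero columns, each of which meets at most \<open>d\<close> rows, so at most \<open>r d\<^sup>2\<close> rows are nonzero.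
  The only layout cuts that are not cuts of the caterpillar separate the boundedly many leaves at
  one spine vertex.\<close>

section \<open>Neighbourhood-width\<close>

text \<open>Generalises \<open>dir_neighbourhood\<close> from the right part of a layout to an
  arbitrary set, so that cuts of a layout and cuts of a tree can be compared directly.\<close>

definition nbrs_in :: "'a pair_pre_digraph \<Rightarrow> 'a set \<Rightarrow> 'a \<Rightarrow> 'a set \<times> 'a set" where
  "nbrs_in G B u = ({v \<in> B. (u, v) \<in> parcs G}, {v \<in> B. (v, u) \<in> parcs G})"

lemma dir_neighbourhood_eq: "dir_neighbourhood G \<phi> i = nbrs_in G (right_part G i \<phi>)"
  by (simp add: fun_eq_iff dir_neighbourhood_def nbrs_in_def)

text \<open>The neighbourhoods in B' are the traces on B' of those in B. Hence classes of vertices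
  can only merge when the right part shrinks.\<close>

lemma nbrs_in_mono_eq:
  assumes "nbrs_in G B u = nbrs_in G B u'" "B' \<subseteq> B"
  shows "nbrs_in G B' u = nbrs_in G B' u'"
proof -
  have "nbrs_in G B' w = (fst (nbrs_in G B w) \<inter> B', snd (nbrs_in G B w) \<inter> B')" for w
    using assms(2) by (auto simp: nbrs_in_def)
  then show ?thesis using assms(1) by simp
qed

text \<open>Taking traces on B' maps classes for B onto classes for B', so a smaller cut has no more
  classes. It therefore suffices to prove inclusions between the sides of tree cuts and of layout
  cuts.\<close>

lemma card_nbrs_in_mono:
  assumes "A' \<subseteq> A" "B' \<subseteq> B" "finite A"
  shows "card (nbrs_in G B' ` A') \<le> card (nbrs_in G B ` A)"
proof -
  have "nbrs_in G B' ` A' = (\<lambda>(X, Y). (X \<inter> B', Y \<inter> B')) ` nbrs_in G B ` A'"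
    using assms(2) by (auto simp: nbrs_in_def image_image intro!: image_cong)
  also have "card \<dots> \<le> card (nbrs_in G B ` A')"
    using assms by (intro card_image_le) (auto intro: finite_subset)
  also have "\<dots> \<le> card (nbrs_in G B ` A)"
    using assms by (intro card_mono) auto
  finally show ?thesis .
qed

lemma finite_left_part: "finite (pverts G) \<Longrightarrow> finite (left_part G i \<phi>)"
  by (simp add: left_part_def)

section \<open>Layouts from enumerations, and layouts of optimal width\<close>

lemma layouts_of_list:
  assumes "distinct ys" "set ys = pverts G"
  obtains \<phi> where "\<phi> \<in> layouts G" "\<And>j. j < length ys \<Longrightarrow> \<phi> (ys ! j) = Suc j"
proof
  define \<phi> where "\<phi> = Suc \<circ> the_inv_into {..<length ys} ((!) ys)"
  have b: "bij_betw ((!) ys) {..<length ys} (pverts G)"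
    using assms by (intro bij_betw_nth) auto
  have "bij_betw Suc {..<length ys} {1..card (pverts G)}"
    using distinct_card[OF assms(1)] assms(2)
    by (auto simp: bij_betw_def image_Suc_lessThan)
  then show "\<phi> \<in> layouts G"
    unfolding \<phi>_def layouts_def
    using bij_betw_trans[OF bij_betw_the_inv_into[OF b]] by blast
  show "\<phi> (ys ! j) = Suc j" if "j < length ys" for j
    using the_inv_into_f_f[OF bij_betw_imp_inj_on[OF b], of j] that by (simp add: \<phi>_def)
qed

lemma layouts_nonempty:
  assumes "finite (pverts G)"
  shows "layouts G \<noteq> {}"
proof -
  obtain ys where "set ys = pverts G" "distinct ys"
    using finite_distinct_list[OF assms] by blast
  then show ?thesis using layouts_of_list by blast
qed

lemma d_nw_le:
  assumes "\<phi> \<in> layouts G"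
    and "\<And>i. i \<in> {1..card (pverts G)} \<Longrightarrow>
      card (nbrs_in G (right_part G i \<phi>) ` left_part G i \<phi>) \<le> k"
  shows "d_nw G \<le> k"
proof -
  have "d_nw G \<le> (SUP i \<in> {1..card (pverts G)}.
     card (nbrs_in G (right_part G i \<phi>) ` left_part G i \<phi>))"
    unfolding d_nw_def dir_neighbourhood_eq by (rule cINF_lower) (use assms(1) in auto)
  also have "\<dots> \<le> k"
  \<comment> \<open>The empty digraph has no index i; its supremum is 0 by convention, while
    \<open>cSUP_least\<close> needs a nonempty index set.\<close>
  proof (cases "card (pverts G) = 0")
    case True
    then show ?thesis by (simp add: Sup_nat_def)
  next
    case False
    then have "{1..card (pverts G)} \<noteq> {}" by simp
    then show ?thesis using assms(2) by (rule cSUP_least)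
  qed
  finally show ?thesis .
qed

text \<open>A finite digraph has a layout, and the infimum of a nonempty set of naturals is
  attained.\<close>

lemma d_nw_layout:
  assumes "finite (pverts G)"
  obtains \<phi> where "\<phi> \<in> layouts G"
    and "\<And>i. i \<in> {1..card (pverts G)} \<Longrightarrow>
      card (nbrs_in G (right_part G i \<phi>) ` left_part G i \<phi>) \<le> d_nw G"
proof -
  let ?w = "\<lambda>\<phi>. SUP i \<in> {1..card (pverts G)}.
     card (nbrs_in G (right_part G i \<phi>) ` left_part G i \<phi>)"
  have "d_nw G \<in> ?w ` layouts G"
    unfolding d_nw_def dir_neighbourhood_eq
    by (rule Inf_nat_def1) (use layouts_nonempty[OF assms] in simp)
  then obtain \<phi> where \<phi>: "\<phi> \<in> layouts G" "d_nw G = ?w \<phi>" by blast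
  show thesis
  proof (rule that[OF \<phi>(1)])
    fix i assume "i \<in> {1..card (pverts G)}"
    then show "card (nbrs_in G (right_part G i \<phi>) ` left_part G i \<phi>) \<le> d_nw G"
      unfolding \<phi>(2) by (intro cSUP_upper) auto
  qed
qed

lemma layout_le_card:
  assumes "\<phi> \<in> layouts G" "u \<in> pverts G"
  shows "1 \<le> \<phi> u" "\<phi> u \<le> card (pverts G)"
proof -
  have "\<phi> u \<in> {1..card (pverts G)}" using assms bij_betwE unfolding layouts_def by blast
  then show "1 \<le> \<phi> u" "\<phi> u \<le> card (pverts G)" by auto
qed

lemma left_part_all:
  assumes "\<phi> \<in> layouts G"
  shows "left_part G (card (pverts G)) \<phi> = pverts G"
  using layout_le_card[OF assms] by (auto simp: left_part_def)

lemma layout_vertexE: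
  assumes "\<phi> \<in> layouts G" "i \<in> {1..card (pverts G)}"
  obtains v where "v \<in> pverts G" "\<phi> v = i"
proof -
  have "i \<in> \<phi> ` pverts G" using assms by (simp add: layouts_def bij_betw_def)
  then show ?thesis using that by blast
qed

lemma left_part_Suc:
  assumes "\<phi> \<in> layouts G" "v \<in> pverts G" "\<phi> v = Suc i"
  shows "left_part G (Suc i) \<phi> = insert v (left_part G i \<phi>)"
    and "right_part G i \<phi> = insert v (right_part G (Suc i) \<phi>)"
proof -
  have eq: "\<phi> u = Suc i \<longleftrightarrow> u = v" if "u \<in> pverts G" for u
    using assms that inj_onD[of \<phi> "pverts G" u v] by (auto simp: layouts_def bij_betw_def)
  have *: "\<phi> u \<le> Suc i \<longleftrightarrow> u = v \<or> \<phi> u \<le> i" "\<phi> u > i \<longleftrightarrow> u = v \<or> \<phi> u > Suc i"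
    if "u \<in> pverts G" for u
    using eq[OF that] by linarith+
  show "left_part G (Suc i) \<phi> = insert v (left_part G i \<phi>)"
    using assms(2) * by (auto simp: left_part_def)
  show "right_part G i \<phi> = insert v (right_part G (Suc i) \<phi>)"
    using assms(2) * by (auto simp: right_part_def)
qed

text \<open>At the last position the left part is the whole vertex set and still has a class. The
  bound is used for the pendant edges of a comb, whose cuts separate at most one vertex and may have
  rank 1.\<close>

lemma d_nw_pos:
  assumes "finite (pverts G)" "pverts G \<noteq> {}"
  shows "1 \<le> d_nw G"
proof -
  obtain \<phi> where \<phi>: "\<phi> \<in> layouts G" "\<And>i. i \<in> {1..card (pverts G)} \<Longrightarrow>
      card (nbrs_in G (right_part G i \<phi>) ` left_part G i \<phi>) \<le> d_nw G"
    using d_nw_layout[OF assms(1)] by blast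
  define n where "n = card (pverts G)"
  have n: "n \<in> {1..card (pverts G)}"
    using assms by (auto simp: n_def Suc_le_eq card_gt_0_iff)
  have "card (nbrs_in G (right_part G n \<phi>) ` left_part G n \<phi>) > 0"
    using assms left_part_all[OF \<phi>(1)] by (auto simp: n_def card_gt_0_iff)
  then show ?thesis using \<phi>(2)[OF n] by simp
qed


section \<open>From labeled constructions to layouts\<close>

text \<open>The label of a vertex is recorded together with its neighbourhood because operations that
  come later treat vertices of equal label alike.\<close>

definition labeled_layout ::
  "nat \<Rightarrow> 'a pair_pre_digraph \<Rightarrow> ('a \<Rightarrow> nat) \<Rightarrow> ('a \<Rightarrow> nat) \<Rightarrow> bool" where
  "labeled_layout k G lab \<phi> \<longleftrightarrow> finite (pverts G) \<and> \<phi> \<in> layouts G \<and> lab ` pverts G \<subseteq> {1..k} \<and>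
     (\<forall>i \<in> {1..card (pverts G)}.
        card ((\<lambda>u. (nbrs_in G (right_part G i \<phi>) u, lab u)) ` left_part G i \<phi>) \<le> k)"

lemma labeled_layout_imp_d_nw_le:
  assumes "labeled_layout k G lab \<phi>"
  shows "d_nw G \<le> k"
proof (rule d_nw_le)
  show "\<phi> \<in> layouts G" using assms by (simp add: labeled_layout_def)
  fix i assume i: "i \<in> {1..card (pverts G)}"
  let ?f = "\<lambda>u. (nbrs_in G (right_part G i \<phi>) u, lab u)"
  have "nbrs_in G (right_part G i \<phi>) ` left_part G i \<phi> = fst ` ?f ` left_part G i \<phi>"
    by (simp add: image_image)
  also have "card \<dots> \<le> card (?f ` left_part G i \<phi>)"
    using assms by (intro card_image_le) (simp add: labeled_layout_def finite_left_part)
  also have "\<dots> \<le> k" using assms i by (simp add: labeled_layout_def)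
  finally show "card (nbrs_in G (right_part G i \<phi>) ` left_part G i \<phi>) \<le> k" .
qed

lemma labeled_layout_vertex:
  assumes "a \<in> {1..k}"
  shows "labeled_layout k \<lparr>pverts = {v}, parcs = {}\<rparr> (\<lambda>_. a) (\<lambda>_. 1)"
  using assms by (auto simp: labeled_layout_def layouts_def bij_betw_def left_part_def nbrs_in_def
      right_part_def)

text \<open>The common pattern of the next lemmas: after an operation, the pair of neighbourhood and
  label of a vertex is a function of the pair before it, so the number of pairs does not
  grow.\<close>

lemma card_image_factor:
  assumes "finite A" "card (f ` A) \<le> k" "\<And>u. u \<in> A \<Longrightarrow> g u = h (f u)"
  shows "card (g ` A) \<le> k"
proof -
  have "g ` A = h ` f ` A" using assms(3) by (auto simp: image_image intro!: image_cong)
  then have "card (g ` A) \<le> card (f ` A)" using assms(1) by (simp add: card_image_le)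
  then show ?thesis using assms(2) by simp
qed

text \<open>The new vertex is placed last. At an earlier cut, whether v joins the neighbourhoods of
  u depends only on the label of u; at the last cut the right part is empty and at most k labels
  remain. The hypothesis \<open>wf\<close> ensures that v has no arcs in H. The sets F and B of
  labels cover both constructions: for linear clique-width they are empty.\<close>

lemma labeled_layout_insert:
  fixes F B :: "nat set"
  assumes l: "labeled_layout k H lab \<phi>" and v: "v \<notin> pverts H" and a: "a \<in> {1..k}"
  defines "E \<equiv> parcs H \<union> {(u, v) | u. u \<in> pverts H \<and> lab u \<in> F}
                      \<union> {(v, u) | u. u \<in> pverts H \<and> lab u \<in> B}"
  defines "G \<equiv> \<lparr>pverts = insert v (pverts H), parcs = E\<rparr>"
  assumes wf: "parcs H \<subseteq> pverts H \<times> pverts H"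
  shows "labeled_layout k G (lab(v := a)) (\<phi>(v := Suc (card (pverts H))))"
proof -
  let ?n = "card (pverts H)" and ?\<psi> = "\<phi>(v := Suc (card (pverts H)))"
  have fin: "finite (pverts H)" and \<phi>: "\<phi> \<in> layouts H" and lab: "lab ` pverts H \<subseteq> {1..k}"
    and k: "\<And>i. i \<in> {1..?n} \<Longrightarrow>
      card ((\<lambda>u. (nbrs_in H (right_part H i \<phi>) u, lab u)) ` left_part H i \<phi>) \<le> k"
    using l by (auto simp: labeled_layout_def)
  have V: "pverts G = insert v (pverts H)" "parcs G = E" by (auto simp: G_def)
  have n: "card (pverts G) = Suc ?n" using v fin by (simp add: V)
  have "bij_betw ?\<psi> (pverts H) {1..?n}"
    using \<phi> v by (subst bij_betw_cong[of _ _ \<phi>]) (auto simp: layouts_def)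
  then have "bij_betw ?\<psi> (pverts H \<union> {v}) ({1..?n} \<union> {?\<psi> v})"
    using v by (intro notIn_Un_bij_betw) auto
  moreover have "{1..?n} \<union> {?\<psi> v} = {1..Suc ?n}" by auto
  ultimately have 1: "?\<psi> \<in> layouts G"
    by (simp add: layouts_def n) (simp add: V)
  have 2: "(lab(v := a)) ` pverts G \<subseteq> {1..k}" using lab a by (auto simp: V)
  have "card ((\<lambda>u. (nbrs_in G (right_part G i ?\<psi>) u, (lab(v := a)) u)) ` left_part G i ?\<psi>) \<le> k"
    if i: "i \<in> {1..Suc ?n}" for i
  proof (cases "i = Suc ?n")
    case True
    have "?\<psi> u \<le> i" if "u \<in> pverts G" for u
      using layout_le_card(2)[OF 1 that] by (simp only: n True)
    then have "right_part G i ?\<psi> = {}" by (auto simp: right_part_def not_less simp del: fun_upd_apply)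
    then have "(\<lambda>u. (nbrs_in G (right_part G i ?\<psi>) u, (lab(v := a)) u)) ` left_part G i ?\<psi>
        \<subseteq> {({}, {})} \<times> {1..k}"
      using 2 by (auto simp: nbrs_in_def left_part_def image_subset_iff simp del: fun_upd_apply)
    from card_mono[OF _ this] show ?thesis by simp
  next
    case False
    with i have i': "i \<in> {1..?n}" by simp
    have L: "left_part G i ?\<psi> = left_part H i \<phi>"
      using i' v by (auto simp: left_part_def V)
    have R: "right_part G i ?\<psi> = insert v (right_part H i \<phi>)"
      using i' v by (auto simp: right_part_def V)
    let ?h = "\<lambda>((X, Y), l). ((if l \<in> F then insert v X else X, if l \<in> B then insert v Y else Y), l)"
    show ?thesis unfolding L R
    proof (rule card_image_factor[OF finite_left_part[OF fin] k[OF i'], where h = ?h])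
      fix u assume u: "u \<in> left_part H i \<phi>"
      then have "u \<in> pverts H" "u \<noteq> v" using v by (auto simp: left_part_def)
      then show "(nbrs_in G (insert v (right_part H i \<phi>)) u, (lab(v := a)) u) =
          ?h (nbrs_in H (right_part H i \<phi>) u, lab u)"
        using v wf by (auto simp: nbrs_in_def V E_def right_part_def)
    qed
  qed
  then show ?thesis
    unfolding labeled_layout_def using 1 2 fin by (simp add: n) (simp add: V)
qed

lemma labeled_layout_relabel:
  assumes l: "labeled_layout k H lab \<phi>" and R: "R ` {1..k} \<subseteq> {1..k}"
  shows "labeled_layout k H (R \<circ> lab) \<phi>"
proof -
  have fin: "finite (pverts H)" using l by (simp add: labeled_layout_def)
  have "card ((\<lambda>u. (nbrs_in H (right_part H i \<phi>) u, (R \<circ> lab) u)) ` left_part H i \<phi>) \<le> k"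
    if "i \<in> {1..card (pverts H)}" for i
    by (rule card_image_factor[where h = "\<lambda>(x, y). (x, R y)"
          and f = "\<lambda>u. (nbrs_in H (right_part H i \<phi>) u, lab u)", OF finite_left_part[OF fin]])
      (use l that in \<open>auto simp: labeled_layout_def\<close>)
  moreover have "(R \<circ> lab) ` pverts H \<subseteq> {1..k}"
    using l R unfolding labeled_layout_def image_comp[symmetric] by blast
  ultimately show ?thesis using l unfolding labeled_layout_def by blast
qed

text \<open>The layout is unchanged. The arcs that u gains across a cut lead to or come from all
  right vertices of one fixed label, and whether u gains them is decided by its own label.\<close>

lemma labeled_layout_add_arcs:
  fixes a b :: nat
  assumes l: "labeled_layout k H lab \<phi>"
  defines "E \<equiv> parcs H \<union> {(u, v). u \<in> pverts H \<and> v \<in> pverts H \<and> lab u = a \<and> lab v = b}"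
  shows "labeled_layout k \<lparr>pverts = pverts H, parcs = E\<rparr> lab \<phi>" (is "labeled_layout k ?G lab \<phi>")
proof -
  have fin: "finite (pverts H)" using l by (simp add: labeled_layout_def)
  have LR: "left_part ?G i \<phi> = left_part H i \<phi>" "right_part ?G i \<phi> = right_part H i \<phi>"
    "layouts ?G = layouts H" for i
    by (auto simp: left_part_def right_part_def layouts_def)
  have "card ((\<lambda>u. (nbrs_in ?G (right_part H i \<phi>) u, lab u)) ` left_part H i \<phi>) \<le> k"
    if "i \<in> {1..card (pverts H)}" for i
  proof (rule card_image_factor[where f = "\<lambda>u. (nbrs_in H (right_part H i \<phi>) u, lab u)"])
    let ?h = "\<lambda>((X, Y), l). ((if l = a then X \<union> {v \<in> right_part H i \<phi>. lab v = b} else X,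
        if l = b then Y \<union> {v \<in> right_part H i \<phi>. lab v = a} else Y), l)"
    show "(nbrs_in ?G (right_part H i \<phi>) u, lab u) = ?h (nbrs_in H (right_part H i \<phi>) u, lab u)"
      if "u \<in> left_part H i \<phi>" for u
      using that by (auto simp: nbrs_in_def E_def right_part_def left_part_def)
  qed (use l that finite_left_part[OF fin] in \<open>auto simp: labeled_layout_def\<close>)
  then show ?thesis using l by (simp add: labeled_layout_def LR)
qed

lemma lnlc_built_wf: "lnlc_built k G lab \<Longrightarrow> parcs G \<subseteq> pverts G \<times> pverts G"
  by (induction rule: lnlc_built.induct) auto

lemma lc_built_wf: "lc_built k G lab \<Longrightarrow> parcs G \<subseteq> pverts G \<times> pverts G"
  by (induction rule: lc_built.induct) auto

lemma lnlc_built_labeled_layout: "lnlc_built k G lab \<Longrightarrow> \<exists>\<phi>. labeled_layout k G lab \<phi>"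
proof (induction rule: lnlc_built.induct)
  case (vertex a v)
  then show ?case by (intro exI[of _ "\<lambda>_. 1"] labeled_layout_vertex)
next
  case (insert H lab v a S\<^sub>f S\<^sub>b)
  then obtain \<phi> where "labeled_layout k H lab \<phi>" by blast
  \<comment> \<open>For the fixed label a of the new vertex, a set of label pairs reduces to a set
    of old labels.\<close>
  from labeled_layout_insert[OF this insert.hyps(2,3) lnlc_built_wf[OF insert.hyps(1)],
      of "{b. (b, a) \<in> S\<^sub>f}" "{b. (b, a) \<in> S\<^sub>b}"]
  show ?case unfolding mem_Collect_eq by blast
next
  case (relabel H lab R)
  then show ?case using labeled_layout_relabel by blast
qed

lemma lc_built_labeled_layout: "lc_built k G lab \<Longrightarrow> \<exists>\<phi>. labeled_layout k G lab \<phi>"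
proof (induction rule: lc_built.induct)
  case (vertex a v)
  then show ?case by (intro exI[of _ "\<lambda>_. 1"] labeled_layout_vertex)
next
  case (insert H lab v a)
  then obtain \<phi> where "labeled_layout k H lab \<phi>" by blast
  from labeled_layout_insert[OF this insert.hyps(2,3) lc_built_wf[OF insert.hyps(1)], of "{}" "{}"]
  have "labeled_layout k \<lparr>pverts = insert v (pverts H), parcs = parcs H\<rparr> (lab(v := a))
      (\<phi>(v := Suc (card (pverts H))))" by simp
  then show ?case by blast
next
  case (add_arcs H lab a b)
  then show ?case using labeled_layout_add_arcs by blast
next
  case (relabel H lab a b)
  then obtain \<phi> where "labeled_layout k H lab \<phi>" by blast
  from labeled_layout_relabel[OF this, of "\<lambda>x. if x = a then b else x"] relabel.hyps
  show ?case by (auto simp: comp_def)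
qed


section \<open>From layouts to labeled constructions\<close>

text \<open>Only what both constructions offer is assumed, so that one argument serves both. In a
  clique-width construction the arcs at v are added after v, label by label: the label a must then
  belong to v alone, and F and B must avoid a.\<close>

locale linear_construction =
  fixes built :: "nat \<Rightarrow> 'a pair_pre_digraph \<Rightarrow> ('a \<Rightarrow> nat) \<Rightarrow> bool"
  assumes built_vertex: "a \<in> {1..k} \<Longrightarrow> built k \<lparr>pverts = {v}, parcs = {}\<rparr> (\<lambda>_. a)"
    and built_insert: "\<lbrakk>built k H lab; finite (pverts H); v \<notin> pverts H; lab ` pverts H \<subseteq> {1..k};
      a \<in> {1..k} - lab ` pverts H; F \<subseteq> {1..k} - {a}; B \<subseteq> {1..k} - {a}\<rbrakk> \<Longrightarrow>
      built k \<lparr>pverts = insert v (pverts H),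
        parcs = parcs H \<union> {(u, v) | u. u \<in> pverts H \<and> lab u \<in> F}
                        \<union> {(v, u) | u. u \<in> pverts H \<and> lab u \<in> B}\<rparr> (lab(v := a))"
    and built_merge: "\<lbrakk>built k H lab; a \<in> {1..k}; b \<in> {1..k}\<rbrakk> \<Longrightarrow>
      built k H (\<lambda>u. if lab u = a then b else lab u)"
begin

text \<open>Merging two labels at a time, rather than renaming all labels at once, needs no spare
  label.\<close>

lemma built_coarsen:
  assumes "built k H lab" "finite (pverts H)" "lab ` pverts H \<subseteq> {1..k}"
    and "\<And>u u'. \<lbrakk>u \<in> pverts H; u' \<in> pverts H; lab u = lab u'\<rbrakk> \<Longrightarrow> f u = f u'"
  shows "\<exists>lab'. built k H lab' \<and> lab' ` pverts H \<subseteq> {1..k} \<and>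
    (\<forall>u \<in> pverts H. \<forall>u' \<in> pverts H. lab' u = lab' u' \<longleftrightarrow> f u = f u')"
  using assms
proof (induction "card (lab ` pverts H)" arbitrary: lab rule: less_induct)
  case less
  show ?case
  proof (cases "\<forall>u \<in> pverts H. \<forall>u' \<in> pverts H. f u = f u' \<longrightarrow> lab u = lab u'")
    case True
    then show ?thesis using less.prems by blast
  next
    case False
    \<comment> \<open>As long as labels are finer than the values of f, two labels share a value;
      merging them lowers the number of labels in use and keeps f constant on each label.\<close>
    then obtain x y where xy: "x \<in> pverts H" "y \<in> pverts H" "f x = f y" "lab x \<noteq> lab y" by blast
    let ?lab = "\<lambda>u. if lab u = lab x then lab y else lab u"
    have "?lab ` pverts H \<subseteq> lab ` pverts H - {lab x}" using xy by auto
    moreover have "card (lab ` pverts H - {lab x}) < card (lab ` pverts H)"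
      using xy less.prems(2) by (intro card_Diff1_less) auto
    ultimately have "card (?lab ` pverts H) < card (lab ` pverts H)"
      using less.prems(2) by (meson card_mono finite_Diff finite_imageI le_less_trans)
    then show ?thesis
    proof (rule less.hyps)
      show "built k H ?lab" using less.prems(1,3) xy by (intro built_merge) auto
      show "?lab ` pverts H \<subseteq> {1..k}" using less.prems(3) xy by auto
      show "f u = f u'" if "u \<in> pverts H" "u' \<in> pverts H" "?lab u = ?lab u'" for u u'
        using that less.prems(4)[of u x] less.prems(4)[of u y] less.prems(4)[of u' x]
          less.prems(4)[of u' y] less.prems(4)[of u u'] xy by (auto split: if_splits)
    qed (use less.prems in auto)
  qed
qed

text \<open>Vertices are inserted in layout order. The invariant \<open>good\<close> says that equal
  labels mean equal neighbourhoods to the right, so at most k labels are in use and one of k + 1 is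
  free for the next vertex. After the insertion the labels refine the classes of the next cut, and
  \<open>built_coarsen\<close> restores the invariant.\<close>

lemma built_of_layout:
  assumes fin: "finite (pverts G)" and wf: "parcs G \<subseteq> pverts G \<times> pverts G"
    and irr: "\<And>v. (v, v) \<notin> parcs G"
    and \<phi>: "\<phi> \<in> layouts G"
    and w: "\<And>i. i \<in> {1..card (pverts G)} \<Longrightarrow>
      card (nbrs_in G (right_part G i \<phi>) ` left_part G i \<phi>) \<le> k"
    and ne: "pverts G \<noteq> {}"
  shows "\<exists>lab. built (Suc k) G lab"
proof -
  define L where "L i = left_part G i \<phi>" for i
  define N where "N i = nbrs_in G (right_part G i \<phi>)" for i
  \<comment> \<open>The subdigraph induced by the first i vertices.\<close>
  define ind where "ind i = \<lparr>pverts = L i, parcs = parcs G \<inter> L i \<times> L i\<rparr>" for i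
  have finL: "finite (L i)" for i using fin by (simp add: L_def finite_left_part)
  define good where "good i lab \<longleftrightarrow> built (Suc k) (ind i) lab \<and> lab ` L i \<subseteq> {1..Suc k} \<and>
    (\<forall>u \<in> L i. \<forall>u' \<in> L i. lab u = lab u' \<longleftrightarrow> N i u = N i u')" for i lab
  \<comment> \<open>The induction starts with one vertex, as the constructions do.\<close>
  have "\<exists>lab. good (Suc i) lab" if "Suc i \<le> card (pverts G)" for i
    using that
  proof (induction i)
    case 0
    then obtain v where v: "v \<in> pverts G" "\<phi> v = Suc 0"
      using layout_vertexE[OF \<phi>, of "Suc 0"] by auto
    have "left_part G 0 \<phi> = {}" using layout_le_card[OF \<phi>] by (fastforce simp: left_part_def)
    then have "L (Suc 0) = {v}" using left_part_Suc(1)[OF \<phi> v] by (simp add: L_def)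
    moreover have "parcs G \<inter> {v} \<times> {v} = {}" using irr by auto
    ultimately have "good (Suc 0) (\<lambda>_. 1)"
      using built_vertex[of 1 "Suc k" v] by (simp add: good_def ind_def)
    then show ?case by (rule exI[of "good (Suc 0)"])
  next
    case (Suc i)
    let ?i = "Suc i"
    from Suc obtain lab where "good ?i lab" by auto
    then have lab: "built (Suc k) (ind ?i) lab" "lab ` L ?i \<subseteq> {1..Suc k}"
      "\<And>u u'. u \<in> L ?i \<Longrightarrow> u' \<in> L ?i \<Longrightarrow> lab u = lab u' \<longleftrightarrow> N ?i u = N ?i u'"
      by (auto simp: good_def)
    obtain v where v: "v \<in> pverts G" "\<phi> v = Suc ?i"
      using layout_vertexE[OF \<phi>, of "Suc ?i"] Suc.prems by auto
    have L: "L (Suc ?i) = insert v (L ?i)" and R: "right_part G ?i \<phi> = insert v (right_part G (Suc ?i) \<phi>)"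
      using left_part_Suc[OF \<phi> v] by (simp_all add: L_def)
    have vL: "v \<notin> L ?i" using v by (simp add: L_def left_part_def)
    \<comment> \<open>By the invariant the label is determined by the class, read off at any
      representative.\<close>
    have "card (lab ` L ?i) \<le> card (N ?i ` L ?i)"
    proof (rule surj_card_le)
      show "lab ` L ?i \<subseteq> (\<lambda>X. lab (SOME u. u \<in> L ?i \<and> N ?i u = X)) ` N ?i ` L ?i"
      proof
        fix c assume "c \<in> lab ` L ?i"
        then obtain u where u: "u \<in> L ?i" "c = lab u" by blast
        let ?u = "SOME u'. u' \<in> L ?i \<and> N ?i u' = N ?i u"
        have "?u \<in> L ?i \<and> N ?i ?u = N ?i u" by (rule someI[of _ u]) (use u in simp)
        then have "c = lab ?u" using lab(3) u by metis
        then show "c \<in> (\<lambda>X. lab (SOME u. u \<in> L ?i \<and> N ?i u = X)) ` N ?i ` L ?i"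
          using u by blast
      qed
    qed (simp add: finL)
    also have "\<dots> \<le> k" using w[of ?i] Suc.prems by (simp add: N_def L_def)
    finally have "card (lab ` L ?i) < card {1..Suc k}" by simp
    then obtain a where a: "a \<in> {1..Suc k} - lab ` L ?i"
      using card_mono[of "lab ` L ?i" "{1..Suc k}"] finL by fastforce
    define F where "F = lab ` {u \<in> L ?i. (u, v) \<in> parcs G}"
    define B where "B = lab ` {u \<in> L ?i. (v, u) \<in> parcs G}"
    have FB: "F \<subseteq> {1..Suc k} - {a}" "B \<subseteq> {1..Suc k} - {a}"
      using lab(2) a unfolding F_def B_def by auto
    \<comment> \<open>The next vertex v still lies in the right part at this cut, so vertices in one
      class agree on their arcs with v. This lets label sets F and B describe the arcs
      exactly.\<close>
    have same: "(u, v) \<in> parcs G \<longleftrightarrow> (u', v) \<in> parcs G" "(v, u) \<in> parcs G \<longleftrightarrow> (v, u') \<in> parcs G"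
      if "u \<in> L ?i" "u' \<in> L ?i" "lab u = lab u'" for u u'
    proof -
      have "N ?i u = N ?i u'" using lab(3) that by blast
      then show "(u, v) \<in> parcs G \<longleftrightarrow> (u', v) \<in> parcs G" "(v, u) \<in> parcs G \<longleftrightarrow> (v, u') \<in> parcs G"
        by (auto simp: N_def nbrs_in_def R)
    qed
    have F: "lab u \<in> F \<longleftrightarrow> (u, v) \<in> parcs G" and B: "lab u \<in> B \<longleftrightarrow> (v, u) \<in> parcs G"
      if "u \<in> L ?i" for u
      using that same unfolding F_def B_def by blast+
    have "built (Suc k) \<lparr>pverts = insert v (pverts (ind ?i)),
        parcs = parcs (ind ?i) \<union> {(u, v) | u. u \<in> pverts (ind ?i) \<and> lab u \<in> F}
                        \<union> {(v, u) | u. u \<in> pverts (ind ?i) \<and> lab u \<in> B}\<rparr> (lab(v := a))"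
      by (rule built_insert[OF lab(1) _ _ _ _ FB]) (use lab(2) a vL finL in \<open>auto simp: ind_def\<close>)
    moreover have "parcs (ind ?i) \<union> {(u, v) | u. u \<in> pverts (ind ?i) \<and> lab u \<in> F}
        \<union> {(v, u) | u. u \<in> pverts (ind ?i) \<and> lab u \<in> B} = parcs (ind (Suc ?i))"
      using irr by (auto simp: ind_def L F B)
    moreover have "insert v (pverts (ind ?i)) = pverts (ind (Suc ?i))" by (simp add: ind_def L)
    ultimately have b1: "built (Suc k) (ind (Suc ?i)) (lab(v := a))" by (simp add: ind_def)
    have b2: "(lab(v := a)) ` pverts (ind (Suc ?i)) \<subseteq> {1..Suc k}"
      using lab(2) a by (auto simp: ind_def L)
    \<comment> \<open>The fresh label isolates v; two older vertices of equal label had equal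
      neighbourhoods before v left the right part.\<close>
    have b3: "N (Suc ?i) u = N (Suc ?i) u'"
      if "u \<in> pverts (ind (Suc ?i))" "u' \<in> pverts (ind (Suc ?i))" "(lab(v := a)) u = (lab(v := a)) u'"
      for u u'
    proof (cases "u = v \<or> u' = v")
      case True
      then have "u = u'" using that a by (auto simp: ind_def L split: if_splits)
      then show ?thesis by simp
    next
      case False
      then have "N ?i u = N ?i u'" using that lab(3)[of u u'] by (auto simp: ind_def L)
      then show ?thesis unfolding N_def by (rule nbrs_in_mono_eq) (auto simp: R)
    qed
    have "finite (pverts (ind (Suc ?i)))" using finL by (simp add: ind_def)
    from built_coarsen[OF b1 this b2, where f = "N (Suc ?i)", OF b3]
    obtain lab' where lab': "built (Suc k) (ind (Suc ?i)) lab'"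
      "lab' ` pverts (ind (Suc ?i)) \<subseteq> {1..Suc k}"
      "\<forall>u \<in> pverts (ind (Suc ?i)). \<forall>u' \<in> pverts (ind (Suc ?i)).
          lab' u = lab' u' \<longleftrightarrow> N (Suc ?i) u = N (Suc ?i) u'" by blast
    have "good (Suc ?i) lab'" unfolding good_def using lab' by (simp add: ind_def)
    then show ?case by blast
  qed
  moreover have "card (pverts G) > 0" using fin ne by (simp add: card_gt_0_iff)
  \<comment> \<open>The claim was shown for successors only, hence the need for a positive number of
    vertices.\<close>
  ultimately obtain lab where "good (card (pverts G)) lab"
    by (metis Suc_pred order_refl)
  moreover have "ind (card (pverts G)) = G"
    using wf left_part_all[OF \<phi>] by (auto simp: ind_def L_def intro!: pair_pre_digraph.equality)
  ultimately show ?thesis by (auto simp: good_def)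
qed

lemma built_d_nw:
  assumes "pair_digraph G" "pverts G \<noteq> {}"
  shows "\<exists>lab. built (Suc (d_nw G)) G lab"
proof -
  interpret pair_digraph G by fact
  obtain \<phi> where \<phi>: "\<phi> \<in> layouts G" "\<And>i. i \<in> {1..card (pverts G)} \<Longrightarrow>
      card (nbrs_in G (right_part G i \<phi>) ` left_part G i \<phi>) \<le> d_nw G"
    using d_nw_layout[OF pair_finite_verts] by blast
  show ?thesis
  proof (rule built_of_layout[OF pair_finite_verts _ _ \<phi> assms(2)])
    show "parcs G \<subseteq> pverts G \<times> pverts G" by (auto dest: in_arcsD1 in_arcsD2)
    show "(v, v) \<notin> parcs G" for v using pair_no_loops[of "(v, v)"] by auto
  qed
qed

end

section \<open>The two constructions as instances, and their widths\<close>

interpretation lnlc: linear_construction lnlc_built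
proof
  fix k a b and H :: "'a pair_pre_digraph" and lab :: "'a \<Rightarrow> nat"
  assume *: "lnlc_built k H lab" "a \<in> {1..k}" "b \<in> {1..k}"
  have "lnlc_built k H ((\<lambda>x. if x = a then b else x) \<circ> lab)"
    by (rule lnlc_built.relabel) (use * in auto)
  then show "lnlc_built k H (\<lambda>u. if lab u = a then b else lab u)" by (simp add: comp_def)
next
  fix k a F B and v :: 'a and H :: "'a pair_pre_digraph" and lab :: "'a \<Rightarrow> nat"
  assume *: "lnlc_built k H lab" "v \<notin> pverts H" "a \<in> {1..k} - lab ` pverts H"
    "F \<subseteq> {1..k} - {a}" "B \<subseteq> {1..k} - {a}"
  \<comment> \<open>Products with {a} turn sets of old labels into sets of label pairs.\<close>
  from lnlc_built.insert[OF *(1,2), of a "F \<times> {a}" "B \<times> {a}"] *(3-)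
  show "lnlc_built k \<lparr>pverts = insert v (pverts H),
        parcs = parcs H \<union> {(u, v) | u. u \<in> pverts H \<and> lab u \<in> F}
                        \<union> {(v, u) | u. u \<in> pverts H \<and> lab u \<in> B}\<rparr> (lab(v := a))"
    by (simp add: Sigma_mono subset_iff)
qed (rule lnlc_built.vertex)

text \<open>One \<open>add_arcs\<close> treats a single pair of distinct labels, so the labels of F
  are handled one after another; the labelling stays the same throughout.\<close>

lemma lc_built_arcs_from:
  assumes "finite F" "lc_built k H lab" "F \<subseteq> {1..k} - {a}" "a \<in> {1..k}"
  shows "lc_built k \<lparr>pverts = pverts H,
      parcs = parcs H \<union> {(u, v). u \<in> pverts H \<and> v \<in> pverts H \<and> lab u \<in> F \<and> lab v = a}\<rparr> lab"
  using assms(1,3)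
proof (induction F rule: finite_induct)
  case empty
  then show ?case using assms(2) by (cases H) simp
next
  case (insert b F)
  then have "lc_built k \<lparr>pverts = pverts H,
      parcs = parcs H \<union> {(u, v). u \<in> pverts H \<and> v \<in> pverts H \<and> lab u \<in> F \<and> lab v = a}\<rparr> lab"
    by simp
  from lc_built.add_arcs[OF this, of b a] show ?case
    by (rule back_subst[of "\<lambda>G. lc_built k G lab"]) (use insert.prems assms(4) in auto)
qed

lemma lc_built_arcs_to:
  assumes "finite B" "lc_built k H lab" "B \<subseteq> {1..k} - {a}" "a \<in> {1..k}"
  shows "lc_built k \<lparr>pverts = pverts H,
      parcs = parcs H \<union> {(u, v). u \<in> pverts H \<and> v \<in> pverts H \<and> lab u = a \<and> lab v \<in> B}\<rparr> lab"
  using assms(1,3)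
proof (induction B rule: finite_induct)
  case empty
  then show ?case using assms(2) by (cases H) simp
next
  case (insert b B)
  then have "lc_built k \<lparr>pverts = pverts H,
      parcs = parcs H \<union> {(u, v). u \<in> pverts H \<and> v \<in> pverts H \<and> lab u = a \<and> lab v \<in> B}\<rparr> lab"
    by simp
  from lc_built.add_arcs[OF this, of a b] show ?case
    by (rule back_subst[of "\<lambda>G. lc_built k G lab"]) (use insert.prems assms(4) in auto)
qed

interpretation lc: linear_construction lc_built
proof
  fix k a F B and v :: 'a and H :: "'a pair_pre_digraph" and lab :: "'a \<Rightarrow> nat"
  assume *: "lc_built k H lab" "v \<notin> pverts H" "a \<in> {1..k} - lab ` pverts H"
    "F \<subseteq> {1..k} - {a}" "B \<subseteq> {1..k} - {a}"
  have fin: "finite F" "finite B" using *(4,5) by (auto intro: finite_subset)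
  have a: "a \<in> {1..k}" using * by blast
  note 1 = lc_built.insert[OF *(1,2) a]
  \<comment> \<open>Since v is the only vertex labelled a, arcs into or out of label a are exactly
    arcs into or out of v.\<close>
  note 2 = lc_built_arcs_to[OF fin(2) lc_built_arcs_from[OF fin(1) 1 *(4) a] *(5) a]
  show "lc_built k \<lparr>pverts = insert v (pverts H),
        parcs = parcs H \<union> {(u, v) | u. u \<in> pverts H \<and> lab u \<in> F}
                        \<union> {(v, u) | u. u \<in> pverts H \<and> lab u \<in> B}\<rparr> (lab(v := a))"
    by (rule back_subst[of "\<lambda>G. lc_built k G (lab(v := a))", OF 2]) (use *(2-) in \<open>auto split: if_splits\<close>)
qed (rule lc_built.vertex lc_built.relabel; assumption)+

text \<open>The extra label serves the vertex about to be inserted. The same construction shows that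
  some k is admissible, so that the \<open>LEAST\<close> is attained and its construction yields a
  layout.\<close>

lemma d_lnlcw_bounds:
  assumes "pair_digraph G" "pverts G \<noteq> {}"
  shows "d_nw G \<le> d_lnlcw G" "d_lnlcw G \<le> Suc (d_nw G)"
proof -
  have ex: "\<exists>lab. lnlc_built (Suc (d_nw G)) G lab" using lnlc.built_d_nw[OF assms] .
  then show "d_lnlcw G \<le> Suc (d_nw G)" unfolding d_lnlcw_def by (rule Least_le)
  have "\<exists>lab. lnlc_built (d_lnlcw G) G lab" unfolding d_lnlcw_def using ex by (rule LeastI)
  then show "d_nw G \<le> d_lnlcw G"
    using lnlc_built_labeled_layout labeled_layout_imp_d_nw_le by blast
qed

lemma d_lcw_bounds:
  assumes "pair_digraph G" "pverts G \<noteq> {}"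
  shows "d_nw G \<le> d_lcw G" "d_lcw G \<le> Suc (d_nw G)"
proof -
  have ex: "\<exists>lab. lc_built (Suc (d_nw G)) G lab" using lc.built_d_nw[OF assms] .
  then show "d_lcw G \<le> Suc (d_nw G)" unfolding d_lcw_def by (rule Least_le)
  have "\<exists>lab. lc_built (d_lcw G) G lab" unfolding d_lcw_def using ex by (rule LeastI)
  then show "d_nw G \<le> d_lcw G"
    using lc_built_labeled_layout labeled_layout_imp_d_nw_le by blast
qed


section \<open>Cut-rank and neighbourhoods\<close>

interpretation fun_vs: vector_space "fun_scale :: 'b::field \<Rightarrow> ('a \<Rightarrow> 'b) \<Rightarrow> 'a \<Rightarrow> 'b"
  by (rule vector_space_fun_scale)

lemma sum_fun_apply: "(\<Sum>z\<in>Z. f z) y = (\<Sum>z\<in>Z. f z y)"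
  by (induction Z rule: infinite_finite_induct) auto

text \<open>The row of x is a function of its neighbourhoods in B, and the dimension is at most the
  number of distinct rows.\<close>

lemma matrix_rank_le_card_rows:
  assumes "finite A"
  shows "matrix_rank A B (adj_gf4 G) \<le> card (nbrs_in G B ` A)"
proof -
  let ?row = "\<lambda>x y. if y \<in> B then adj_gf4 G x y else 0"
  have "matrix_rank A B (adj_gf4 G) \<le> card (?row ` A)"
    unfolding matrix_rank_def using assms by (intro fun_vs.dim_le_card fun_vs.span_superset) simp
  also have "\<dots> \<le> card (nbrs_in G B ` A)"
  proof (rule card_image_factor[OF assms order_refl])
    fix x
    show "?row x = (\<lambda>(X, Y) y. if y \<in> B then (if y \<in> X then (if y \<in> Y then GF4_1 else GF4_w)
        else (if y \<in> Y then GF4_w2 else GF4_0)) else 0) (nbrs_in G B x)"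
      by (auto simp: nbrs_in_def adj_gf4_def)
  qed
  finally show ?thesis .
qed

text \<open>Every row is constant on each class of columns with equal neighbourhoods in A, so the
  indicator functions of these classes span all rows. This takes the place of a comparison between
  row rank and column rank.\<close>

lemma matrix_rank_le_card_columns:
  assumes "finite B"
  shows "matrix_rank A B (adj_gf4 G) \<le> card (nbrs_in G A ` B)"
proof -
  define c where "c = nbrs_in G A"
  define ind :: "'a set \<times> 'a set \<Rightarrow> 'a \<Rightarrow> gf4" where "ind z y = (if y \<in> B \<and> c y = z then 1 else 0)" for z y
  let ?row = "\<lambda>x y. if y \<in> B then adj_gf4 G x y else 0"
  have "?row x \<in> fun_vs.span (ind ` c ` B)" if "x \<in> A" for x
  proof -
    \<comment> \<open>The common entry of row x on the columns of class z.\<close>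
    define m where "m z = adj_gf4 G x (SOME y. y \<in> B \<and> c y = z)" for z
    have m: "m (c y) = adj_gf4 G x y" if "y \<in> B" for y
    proof -
      let ?y = "SOME y'. y' \<in> B \<and> c y' = c y"
      have "?y \<in> B \<and> c ?y = c y" by (rule someI[of _ y]) (use that in simp)
      then have "c ?y = c y" by simp
      then have "(x, ?y) \<in> parcs G \<longleftrightarrow> (x, y) \<in> parcs G" "(?y, x) \<in> parcs G \<longleftrightarrow> (y, x) \<in> parcs G"
        using \<open>x \<in> A\<close> by (auto simp: c_def nbrs_in_def)
      then show ?thesis by (simp add: m_def adj_gf4_def)
    qed
    have "?row x = (\<Sum>z\<in>c ` B. fun_scale (m z) (ind z))"
    proof
      fix y
      have "(\<Sum>z\<in>c ` B. fun_scale (m z) (ind z)) y = (\<Sum>z\<in>c ` B. if z = c y then ?row x y else 0)"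
        unfolding sum_fun_apply by (rule sum.cong) (auto simp: fun_scale_def ind_def m)
      also have "\<dots> = ?row x y" using assms by (auto simp: sum.delta)
      finally show "?row x y = (\<Sum>z\<in>c ` B. fun_scale (m z) (ind z)) y" ..
    qed
    also have "\<dots> \<in> fun_vs.span (ind ` c ` B)"
      by (intro fun_vs.span_sum fun_vs.span_scale fun_vs.span_base) blast
    finally show ?thesis .
  qed
  then have "matrix_rank A B (adj_gf4 G) \<le> card (ind ` c ` B)"
    unfolding matrix_rank_def using assms by (intro fun_vs.dim_le_card) auto
  also have "\<dots> \<le> card (c ` B)" using assms by (intro card_image_le) simp
  finally show ?thesis by (simp add: c_def)
qed

section \<open>Few neighbourhoods from small rank and bounded degree\<close>

definition adjacent :: "'a pair_pre_digraph \<Rightarrow> 'a \<Rightarrow> 'a set" where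
  "adjacent G x = {y. (x, y) \<in> parcs G \<or> (y, x) \<in> parcs G}"

lemma adj_gf4_eq_0_iff: "adj_gf4 G x y = 0 \<longleftrightarrow> y \<notin> adjacent G x"
  by (auto simp: adj_gf4_def adjacent_def zero_gf4_def)

lemma (in pair_fin_digraph) finite_adjacent: "finite (adjacent G x)"
  by (rule finite_subset[of _ "pverts G"])
    (auto simp: adjacent_def pair_finite_verts dest: in_arcsD1 in_arcsD2)

lemma (in pair_fin_digraph) card_adjacent_le: "card (adjacent G x) \<le> max_degree G"
proof (cases "x \<in> pverts G")
  case True
  have "adjacent G x = snd ` out_arcs G x \<union> fst ` in_arcs G x"
    by (force simp: adjacent_def)
  also have "card \<dots> \<le> card (snd ` out_arcs G x) + card (fst ` in_arcs G x)" by (rule card_Un_le)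
  also have "\<dots> \<le> out_degree G x + in_degree G x"
    unfolding out_degree_def in_degree_def
    by (intro add_mono card_image_le finite_subset[OF _ pair_finite_arcs]) auto
  also have "\<dots> \<le> max_degree G"
    unfolding max_degree_def using True by (intro cSUP_upper) (auto simp: pair_finite_verts)
  finally show ?thesis .
next
  case False
  then have "adjacent G x = {}" by (auto simp: adjacent_def dest: in_arcsD1 in_arcsD2)
  then show ?thesis by simp
qed

text \<open>A row can be nonzero only in a column where some basis row is nonzero. So a vertex with
  a nonzero row shares a neighbour with a vertex of the basis, which leaves at most d^2 candidates
  per basis row. All zero rows form one further class, hence the \<open>Suc\<close>.\<close>

lemma (in pair_fin_digraph) card_nbrs_in_le_matrix_rank:
  assumes "finite A" "max_degree G \<le> d"
  shows "card (nbrs_in G B ` A) \<le> Suc (matrix_rank A B (adj_gf4 G) * (d * d))"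
proof -
  let ?row = "\<lambda>x y. if y \<in> B then adj_gf4 G x y else 0"
  obtain W where W: "W \<subseteq> ?row ` A" "?row ` A \<subseteq> fun_vs.span W" "card W = matrix_rank A B (adj_gf4 G)"
    unfolding matrix_rank_def by (rule fun_vs.basis_exists)
  \<comment> \<open>One vertex per basis row, so that the rank becomes a number of vertices.\<close>
  obtain A' where A': "A' \<subseteq> A" "inj_on ?row A'" "W = ?row ` A'"
    using W(1) by (auto simp: subset_image_inj)
  have finA': "finite A'" using A'(1) assms(1) by (rule finite_subset)
  have cardA': "card A' = matrix_rank A B (adj_gf4 G)" using card_image[OF A'(2)] W(3) A'(3) by simp
  define U where "U = (\<Union>x'\<in>A'. \<Union>y\<in>adjacent G x'. adjacent G y)"
  have zero: "nbrs_in G B x = ({}, {})" if x: "x \<in> A" "x \<notin> U" for x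
  proof -
    \<comment> \<open>The functions that vanish wherever all basis rows vanish form a subspace,
      which therefore contains the span.\<close>
    have "fun_vs.subspace {g. \<forall>y. (\<forall>w\<in>W. w y = 0) \<longrightarrow> g y = (0::gf4)}"
      by (auto simp: fun_vs.subspace_def fun_scale_def)
    then have "fun_vs.span W \<subseteq> {g. \<forall>y. (\<forall>w\<in>W. w y = 0) \<longrightarrow> g y = 0}"
      by (intro fun_vs.span_minimal) auto
    then have s: "\<exists>w\<in>W. w y \<noteq> 0" if "?row x y \<noteq> 0" for y using W(2) x(1) that by blast
    have "y \<notin> adjacent G x" if "y \<in> B" for y
    proof
      assume y: "y \<in> adjacent G x"
      then have "?row x y \<noteq> 0" using that by (simp add: adj_gf4_eq_0_iff)
      from s[OF this] obtain x' where "x' \<in> A'" "?row x' y \<noteq> 0" using A'(3) by blast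
      then have "y \<in> adjacent G x'" "x' \<in> A'" by (auto simp: adj_gf4_eq_0_iff split: if_splits)
      moreover have "x \<in> adjacent G y" using y by (auto simp: adjacent_def)
      ultimately show False using x(2) by (auto simp: U_def)
    qed
    then show ?thesis by (auto simp: nbrs_in_def adjacent_def)
  qed
  have finU: "finite U" using finA' finite_adjacent by (auto simp: U_def)
  have ca: "card (adjacent G x) \<le> d" for x using card_adjacent_le assms(2) by (rule order_trans)
  have "card (\<Union>y\<in>adjacent G x'. adjacent G y) \<le> d * d" for x'
  proof -
    have "card (\<Union>y\<in>adjacent G x'. adjacent G y) \<le> (\<Sum>y\<in>adjacent G x'. card (adjacent G y))"
      by (rule card_UN_le) (rule finite_adjacent)
    also have "\<dots> \<le> card (adjacent G x') * d" 
      using sum_bounded_above[of "adjacent G x'" "\<lambda>y. card (adjacent G y)" d] ca by simp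
    also have "\<dots> \<le> d * d" using ca by simp
    finally show ?thesis .
  qed
  then have "(\<Sum>x'\<in>A'. card (\<Union>y\<in>adjacent G x'. adjacent G y)) \<le> card A' * (d * d)"
    using sum_bounded_above[of A' "\<lambda>x'. card (\<Union>y\<in>adjacent G x'. adjacent G y)" "d * d"] by simp
  from order_trans[OF card_UN_le[OF finA'] this] have cU: "card U \<le> card A' * (d * d)"
    unfolding U_def .
  have "nbrs_in G B ` A \<subseteq> insert ({}, {}) (nbrs_in G B ` U)" using zero by blast
  then have "card (nbrs_in G B ` A) \<le> card (insert ({}, {}) (nbrs_in G B ` U))"
    using finU by (intro card_mono) auto
  also have "\<dots> \<le> Suc (card (nbrs_in G B ` U))" by (rule card_insert_le_m1) simp_all
  also have "\<dots> \<le> Suc (card U)" using finU by (simp add: card_image_le)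
  finally show ?thesis using cU cardA' by simp
qed


section \<open>From layouts to caterpillars\<close>

text \<open>A set that contains s and is closed under the remaining arcs contains all that is
  reachable from s. Upper bounds on the sides are enough, by
  \<open>card_nbrs_in_mono\<close>.\<close>

lemma edge_side_subset:
  assumes "s \<in> S" "\<And>a b. \<lbrakk>(a, b) \<in> parcs T; (a, b) \<noteq> (s, t); (a, b) \<noteq> (t, s); a \<in> S\<rbrakk> \<Longrightarrow> b \<in> S"
  shows "edge_side G T f s t \<subseteq> {x \<in> pverts G. f x \<in> S}"
proof -
  have "b \<in> S" if "s \<rightarrow>\<^sup>*\<^bsub>with_proj (del_edge T s t)\<^esub> b" for b
    using that unfolding reachable_def
    by (induction rule: rtrancl_on_induct) (use assms in \<open>auto simp: del_edge_def\<close>)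
  then show ?thesis by (auto simp: edge_side_def)
qed

text \<open>The spine is 0, ..., n - 1 and n + i is the pendant vertex at i. One pendant per spine
  vertex keeps the degrees at most three.\<close>

definition comb :: "nat \<Rightarrow> nat pair_pre_digraph" where
  "comb n = (let D = {(i, Suc i) | i. Suc i < n} \<union> {(n + i, i) | i. i < n}
     in \<lparr>pverts = {..<2 * n}, parcs = D \<union> D\<inverse>\<rparr>)"

lemma pverts_comb: "pverts (comb n) = {..<2 * n}"
  by (simp add: comb_def Let_def)

lemma comb_arc_iff: "(a, b) \<in> parcs (comb n) \<longleftrightarrow>
    b = Suc a \<and> b < n \<or> a = Suc b \<and> a < n \<or> a = n + b \<and> b < n \<or> b = n + a \<and> a < n"
  by (auto simp: comb_def Let_def)

lemma set_zip_tl: "set (zip xs (tl xs)) = (\<lambda>j. (xs ! j, xs ! Suc j)) ` {j. Suc j < length xs}"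
  by (auto simp: set_zip nth_tl)

lemma caterpillar_comb:
  assumes "n \<ge> 1"
  shows "caterpillar (comb n)"
proof -
  have "set (zip [0..<n] (tl [0..<n])) = (\<lambda>i. (i, Suc i)) ` {i. Suc i < n}"
    unfolding set_zip_tl by (rule image_cong) auto
  then have z: "set (zip [0..<n] (tl [0..<n])) = {(i, Suc i) | i. Suc i < n}" by auto
  have h: "{(q, q - n) | q. q \<in> {..<2 * n} - set [0..<n]} = {(n + i, i) | i. i < n}"
  proof (intro equalityI subsetI)
    fix p assume "p \<in> {(q, q - n) | q. q \<in> {..<2 * n} - set [0..<n]}"
    then obtain q where q: "p = (q, q - n)" "q < 2 * n" "n \<le> q" by auto
    then have "p = (n + (q - n), q - n) \<and> q - n < n" by auto
    then show "p \<in> {(n + i, i) | i. i < n}" by blast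
  next
    fix p assume "p \<in> {(n + i, i) | i. i < n}"
    then obtain i where "p = (n + i, n + i - n)" "n + i \<in> {..<2 * n} - set [0..<n]" by auto
    then show "p \<in> {(q, q - n) | q. q \<in> {..<2 * n} - set [0..<n]}" by blast
  qed
  have "[0..<n] \<noteq> [] \<and> distinct [0..<n] \<and> set [0..<n] \<subseteq> pverts (comb n) \<and>
      (\<lambda>q. q - n) ` (pverts (comb n) - set [0..<n]) \<subseteq> set [0..<n]"
    using assms by (auto simp: pverts_comb)
  moreover have "let D = set (zip [0..<n] (tl [0..<n])) \<union> {(q, q - n) | q. q \<in> pverts (comb n) - set [0..<n]}
      in parcs (comb n) = D \<union> D\<inverse>"
    unfolding pverts_comb z h by (simp add: comb_def Let_def)
  ultimately show ?thesis unfolding caterpillar_def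
    by (intro conjI exI[of _ "[0..<n]"] exI[of _ "\<lambda>q. q - n"]) (auto simp: pverts_comb)
qed

lemma finite_comb_arcs: "finite (parcs (comb n))"
  by (rule finite_subset[of _ "{..<2 * n} \<times> {..<2 * n}"]) (auto simp: comb_arc_iff)

lemma out_arcs_comb: "out_arcs (with_proj (comb n)) t = {(t, b) | b. (t, b) \<in> parcs (comb n)}"
  by (auto simp: out_arcs_def)

lemma out_degree_comb_le: "out_degree (comb n) t \<le> 3"
proof (cases "t < n")
  case True
  then have "out_arcs (with_proj (comb n)) t \<subseteq> {(t, Suc t), (t, t - 1), (t, n + t)}"
    by (auto simp: out_arcs_comb comb_arc_iff)
  from card_mono[OF _ this] show ?thesis
    unfolding out_degree_def by (rule order_trans) (auto simp: card_insert_if)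
next
  case False
  then have "out_arcs (with_proj (comb n)) t \<subseteq> {(t, t - n)}"
    by (auto simp: out_arcs_comb comb_arc_iff)
  from card_mono[OF _ this] show ?thesis
    unfolding out_degree_def by simp
qed

text \<open>A spine vertex has its pendant and, because n is at least 2, a neighbour on the spine.
  For n = 1 the single spine vertex would be a second leaf.\<close>

lemma leaves_comb:
  assumes "n \<ge> 2"
  shows "leaves (comb n) = {n..<2 * n}"
proof -
  have fin: "finite (out_arcs (with_proj (comb n)) t)" for t
    by (rule finite_subset[OF _ finite_comb_arcs]) auto
  have 1: "\<not> out_degree (comb n) t \<le> 1" if "t < n" for t
  proof -
    \<comment> \<open>A spine neighbour of t: the next vertex, or the previous one at the end of the
      spine.\<close>
    define b where "b = (if Suc t < n then Suc t else t - 1)"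
    have "{(t, b), (t, n + t)} \<subseteq> out_arcs (with_proj (comb n)) t"
      using that assms by (auto simp: out_arcs_comb comb_arc_iff b_def)
    from card_mono[OF fin this] have "card {(t, b), (t, n + t)} \<le> out_degree (comb n) t"
      by (simp add: out_degree_def)
    moreover have "b < n" using that by (auto simp: b_def)
    ultimately show ?thesis by auto
  qed
  have 2: "out_degree (comb n) t \<le> 1" if "\<not> t < n" for t
  proof -
    have "out_arcs (with_proj (comb n)) t \<subseteq> {(t, t - n)}"
      using that by (auto simp: out_arcs_comb comb_arc_iff)
    from card_mono[OF _ this] show ?thesis
      unfolding out_degree_def by simp
  qed
  have iff: "out_degree (comb n) t \<le> 1 \<longleftrightarrow> n \<le> t" for t
    using 1[of t] 2[of t] by (cases "t < n") auto
  have "leaves (comb n) = {t \<in> {..<2 * n}. n \<le> t}" unfolding leaves_def pverts_comb iff ..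
  also have "\<dots> = {n..<2 * n}" by auto
  finally show ?thesis .
qed

text \<open>The vertex at position i + 1 sits on the leaf n + i. Deleting the spine edge between i
  and i + 1 yields the layout cut after position i + 1; deleting a pendant edge separates at most
  one vertex, which gives rank at most 1.\<close>

lemma matrix_rank_comb_le:
  assumes fin: "finite (pverts G)" and \<phi>: "\<phi> \<in> layouts G"
    and w: "\<And>i. i \<in> {1..card (pverts G)} \<Longrightarrow>
      card (nbrs_in G (right_part G i \<phi>) ` left_part G i \<phi>) \<le> k"
    and k: "1 \<le> k"
    and e: "(s, t) \<in> parcs (comb (card (pverts G)))"
  defines "f \<equiv> \<lambda>x. card (pverts G) + (\<phi> x - 1)"
  defines "side \<equiv> edge_side G (comb (card (pverts G))) f"
  shows "matrix_rank (side s t) (side t s) (adj_gf4 G) \<le> k"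
proof -
  define n where "n = card (pverts G)"
  have \<phi>n: "1 \<le> \<phi> x \<and> \<phi> x \<le> n" if "x \<in> pverts G" for x
    using layout_le_card[OF \<phi> that] by (simp add: n_def)
  have finside: "finite (side a b)" for a b
    using fin by (auto simp: side_def edge_side_def)
  have rows: "matrix_rank (side a b) (side b a) (adj_gf4 G) \<le> card (nbrs_in G (side b a) ` side a b)" for a b
    by (rule matrix_rank_le_card_rows[OF finside])
  have cols: "matrix_rank (side a b) (side b a) (adj_gf4 G) \<le> card (nbrs_in G (side a b) ` side b a)" for a b
    by (rule matrix_rank_le_card_columns[OF finside])
  have spine: "card (nbrs_in G (side (Suc i) i) ` side i (Suc i)) \<le> k" if "Suc i < n" for i
  proof -
    have "side i (Suc i) \<subseteq> {x \<in> pverts G. f x \<in> {j. j \<le> i \<or> n \<le> j \<and> j \<le> n + i}}"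
      unfolding side_def n_def[symmetric] by (rule edge_side_subset) (use that in \<open>auto simp: comb_arc_iff\<close>)
    then have L: "side i (Suc i) \<subseteq> left_part G (Suc i) \<phi>"
      using that by (auto simp: left_part_def f_def n_def[symmetric])
    have "side (Suc i) i \<subseteq> {x \<in> pverts G. f x \<in> {j. i < j \<and> j < n \<or> n + i < j}}"
      unfolding side_def n_def[symmetric] by (rule edge_side_subset) (use that in \<open>auto simp: comb_arc_iff\<close>)
    then have R: "side (Suc i) i \<subseteq> right_part G (Suc i) \<phi>"
      by (auto simp: right_part_def f_def n_def[symmetric])
    have "card (nbrs_in G (side (Suc i) i) ` side i (Suc i)) \<le>
        card (nbrs_in G (right_part G (Suc i) \<phi>) ` left_part G (Suc i) \<phi>)"
      using L R finite_left_part[OF fin] by (rule card_nbrs_in_mono)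
    also have "\<dots> \<le> k" using that by (intro w) (simp add: n_def)
    finally show ?thesis .
  qed
  have pendant: "card (nbrs_in G B ` side (n + i) i) \<le> k" if "i < n" for i B
  proof -
    have "side (n + i) i \<subseteq> {x \<in> pverts G. f x \<in> {n + i}}"
      unfolding side_def n_def[symmetric] by (rule edge_side_subset) (use that in \<open>auto simp: comb_arc_iff\<close>)
    also have "\<dots> \<subseteq> {x \<in> pverts G. \<phi> x = Suc i}"
    proof
      fix x assume "x \<in> {x \<in> pverts G. f x \<in> {n + i}}"
      then have "x \<in> pverts G" "\<phi> x - 1 = i" by (auto simp: f_def n_def[symmetric])
      moreover from this have "\<phi> x = Suc i" using \<phi>n[of x] by linarith
      ultimately show "x \<in> {x \<in> pverts G. \<phi> x = Suc i}" by simp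
    qed
    finally have sub: "side (n + i) i \<subseteq> {x \<in> pverts G. \<phi> x = Suc i}" .
    have inj: "inj_on \<phi> (pverts G)" using \<phi> by (simp add: layouts_def bij_betw_def)
    have "card (nbrs_in G B ` side (n + i) i) \<le> card (side (n + i) i)"
      by (rule card_image_le[OF finside])
    also have "\<dots> \<le> 1"
    proof -
      have "x = y" if "x \<in> side (n + i) i" "y \<in> side (n + i) i" for x y
        using subsetD[OF sub that(1)] subsetD[OF sub that(2)] inj_onD[OF inj, of x y] by simp
      then show ?thesis using card_le_Suc0_iff_eq[OF finside] by auto
    qed
    finally show ?thesis using k by simp
  qed
  \<comment> \<open>Where the orientation makes the earlier vertices, or the single vertex, index
    the columns, the column bound is used instead of the row bound.\<close>
  from e consider "t = Suc s" "t < n" | "s = Suc t" "s < n" | "s = n + t" "t < n" | "t = n + s" "s < n"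
    by (auto simp: comb_arc_iff n_def)
  then show ?thesis
  proof cases
    case 1
    then show ?thesis using rows[of s t] spine[of s] by simp
  next
    case 2
    then show ?thesis using cols[of s t] spine[of t] by simp
  next
    case 3
    then show ?thesis using rows[of s t] pendant[of t "side t s"] by simp
  next
    case 4
    then show ?thesis using cols[of s t] pendant[of s "side s t"] by simp
  qed
qed

lemma linear_rank_decomposition_exists:
  assumes fin: "finite (pverts G)" and ne: "pverts G \<noteq> {}"
  shows "\<exists>(T :: nat pair_pre_digraph) f. linear_rank_decomposition G T f \<and> decomposition_width G T f \<le> d_nw G"
proof (cases "card (pverts G) = 1")
  case True
  then obtain v where v: "pverts G = {v}" by (rule card_1_singletonE)
  \<comment> \<open>The comb with n = 1 has two leaves; a single vertex needs the one-vertex tree,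
    which has no edges and hence width 0.\<close>
  let ?T = "\<lparr>pverts = {0}, parcs = {}\<rparr> :: nat pair_pre_digraph"
  have "caterpillar ?T"
    unfolding caterpillar_def Let_def by (intro conjI exI[of _ "[0]"] exI[of _ id]) auto
  moreover have "out_degree ?T t = 0" for t
    by (simp add: out_degree_def out_arcs_def)
  ultimately have "linear_rank_decomposition G ?T (\<lambda>_. 0)"
    by (auto simp: linear_rank_decomposition_def leaves_def bij_betw_def v)
  moreover have "decomposition_width G ?T (\<lambda>_. 0) = 0"
    by (simp add: decomposition_width_def Sup_nat_def)
  ultimately show ?thesis by (metis le0)
next
  case False
  define n where "n = card (pverts G)"
  have n: "n \<ge> 2" using False fin ne card_gt_0_iff[of "pverts G"] unfolding n_def by linarith
  obtain \<phi> where \<phi>: "\<phi> \<in> layouts G" "\<And>i. i \<in> {1..card (pverts G)} \<Longrightarrow>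
      card (nbrs_in G (right_part G i \<phi>) ` left_part G i \<phi>) \<le> d_nw G"
    using d_nw_layout[OF fin] by blast
  define f where "f = (\<lambda>x. card (pverts G) + (\<phi> x - 1))"
  have "bij_betw (\<lambda>i. n + (i - 1)) {1..n} {n..<2 * n}"
    by (rule bij_betwI[where g = "\<lambda>j. j - n + 1"]) auto
  moreover have "bij_betw \<phi> (pverts G) {1..n}" using \<phi>(1) by (simp add: layouts_def n_def)
  ultimately have "bij_betw f (pverts G) (leaves (comb n))"
    unfolding leaves_comb[OF n] using bij_betw_trans by (fastforce simp: f_def n_def comp_def)
  then have "linear_rank_decomposition G (comb n) f"
    using n caterpillar_comb[of n] by (simp add: linear_rank_decomposition_def out_degree_comb_le)
  moreover have "decomposition_width G (comb n) f \<le> d_nw G"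
    unfolding decomposition_width_def
  proof (rule cSUP_least)
    have "(0, Suc 0) \<in> parcs (comb n)" using n by (simp add: comb_arc_iff)
    then show "parcs (comb n) \<noteq> {}" by blast
    fix e assume "e \<in> parcs (comb n)"
    then show "(case e of (s, t) \<Rightarrow> matrix_rank (edge_side G (comb n) f s t)
        (edge_side G (comb n) f t s) (adj_gf4 G)) \<le> d_nw G"
      using matrix_rank_comb_le[OF fin \<phi> d_nw_pos[OF fin ne], of "fst e" "snd e"]
      by (cases e) (simp add: f_def n_def)
  qed
  ultimately show ?thesis by blast
qed


section \<open>From caterpillars to layouts\<close>

text \<open>Only the arcs along the path are assumed, so that the lemma applies to a caterpillar
  with one spine edge deleted.\<close>

lemma reachable_spine_down:
  assumes "m < length ps" "set ps \<subseteq> pverts T"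
    "\<And>j. Suc j \<le> m \<Longrightarrow> (ps ! Suc j, ps ! j) \<in> parcs T" "j \<le> m"
  shows "ps ! m \<rightarrow>\<^sup>*\<^bsub>with_proj T\<^esub> ps ! j"
  using assms(4)
proof (induction rule: inc_induct)
  case base
  then show ?case using assms by (auto simp: reachable_def)
next
  case (step j)
  then have "(ps ! Suc j, ps ! j) \<in> parcs T" "ps ! j \<in> pverts T"
    using assms(1,2) assms(3)[of j] by auto
  with step.IH show ?case
    unfolding reachable_def with_proj_simps by (rule rtrancl_on_into_rtrancl_on)
qed

lemma reachable_spine_up:
  assumes "set ps \<subseteq> pverts T" "m \<le> j" "j < length ps"
    "\<And>j. m \<le> j \<Longrightarrow> Suc j < length ps \<Longrightarrow> (ps ! j, ps ! Suc j) \<in> parcs T"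
  shows "ps ! m \<rightarrow>\<^sup>*\<^bsub>with_proj T\<^esub> ps ! j"
  using assms(2,3)
proof (induction rule: dec_induct)
  case base
  then show ?case using assms by (auto simp: reachable_def)
next
  case (step j)
  then have "(ps ! j, ps ! Suc j) \<in> parcs T" "ps ! Suc j \<in> pverts T"
    using assms(1) assms(4)[of j] by auto
  with step.IH step.prems show ?case
    unfolding reachable_def with_proj_simps by (auto intro: rtrancl_on_into_rtrancl_on)
qed

text \<open>Here \<open>ps\<close> is the spine, and \<open>pos\<close> gives the index of a spine
  vertex itself or of the spine vertex that a pendant is attached to. The last two facts place the
  vertices before and after a spine edge on its two sides.\<close>

lemma caterpillar_positions:
  assumes "caterpillar T"
  obtains ps pos where
    "finite (parcs T)"
    "\<And>j. j < length ps \<Longrightarrow> ps ! j \<in> pverts T"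
    "\<And>j. Suc j < length ps \<Longrightarrow> (ps ! j, ps ! Suc j) \<in> parcs T"
    "\<And>q. q \<in> pverts T \<Longrightarrow> pos q < length ps"
    "\<And>q. q \<in> pverts T \<Longrightarrow> q = ps ! pos q \<or> (ps ! pos q, q) \<in> parcs T"
    "\<And>m q. \<lbrakk>Suc m < length ps; q \<in> pverts T; pos q \<le> m\<rbrakk> \<Longrightarrow>
       ps ! m \<rightarrow>\<^sup>*\<^bsub>with_proj (del_edge T (ps ! m) (ps ! Suc m))\<^esub> q"
    "\<And>m q. \<lbrakk>Suc m < length ps; q \<in> pverts T; m < pos q\<rbrakk> \<Longrightarrow>
       ps ! Suc m \<rightarrow>\<^sup>*\<^bsub>with_proj (del_edge T (ps ! Suc m) (ps ! m))\<^esub> q"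
proof -
  obtain ps h where ps: "ps \<noteq> []" "distinct ps" "set ps \<subseteq> pverts T" "h ` (pverts T - set ps) \<subseteq> set ps"
    and D: "parcs T = (set (zip ps (tl ps)) \<union> {(q, h q) | q. q \<in> pverts T - set ps})
      \<union> (set (zip ps (tl ps)) \<union> {(q, h q) | q. q \<in> pverts T - set ps})\<inverse>"
    and finV: "finite (pverts T)"
    using assms unfolding caterpillar_def Let_def by blast
  have arc: "(ps ! j, ps ! Suc j) \<in> parcs T" "(ps ! Suc j, ps ! j) \<in> parcs T" if "Suc j < length ps" for j
    using that unfolding D set_zip_tl by auto
  define hub where "hub q = (if q \<in> set ps then q else h q)" for q
  have "\<forall>q \<in> pverts T. \<exists>j. j < length ps \<and> ps ! j = hub q"
    using ps(4) by (auto simp: hub_def in_set_conv_nth[symmetric])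
  then obtain pos where pos: "\<And>q. q \<in> pverts T \<Longrightarrow> pos q < length ps \<and> ps ! pos q = hub q"
    by (meson bchoice)
  have hub: "q = hub q \<or> q \<notin> set ps \<and> (hub q, q) \<in> parcs T" if "q \<in> pverts T" for q
    using that unfolding D hub_def by auto
  \<comment> \<open>Both ends of the deleted edge lie on the spine, so an arc from the spine to a
    pendant survives.\<close>
  have ext: "s \<rightarrow>\<^sup>*\<^bsub>with_proj (del_edge T a b)\<^esub> q"
    if "s \<rightarrow>\<^sup>*\<^bsub>with_proj (del_edge T a b)\<^esub> ps ! pos q" "q \<in> pverts T" "a \<in> set ps" "b \<in> set ps" for s a b q
    using that hub[of q] pos[of q]
    by (auto simp: reachable_def del_edge_def intro: rtrancl_on_into_rtrancl_on)
  have inj: "ps ! i = ps ! j \<longleftrightarrow> i = j" if "i < length ps" "j < length ps" for i j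
    using ps(2) that by (simp add: nth_eq_iff_index_eq)
  show thesis
  proof (rule that[of ps pos])
    have "parcs T \<subseteq> pverts T \<times> pverts T"
      using ps(3,4) unfolding D set_zip_tl by (auto dest: nth_mem Suc_lessD)
    then show "finite (parcs T)" using finV by (meson finite_SigmaI finite_subset)
    show "ps ! j \<in> pverts T" if "j < length ps" for j using ps(3) nth_mem[OF that] by blast
    show "(ps ! j, ps ! Suc j) \<in> parcs T" if "Suc j < length ps" for j using arc that by blast
    show "pos q < length ps" "q = ps ! pos q \<or> (ps ! pos q, q) \<in> parcs T" if "q \<in> pverts T" for q
      using pos[OF that] hub[OF that] by auto
    fix m q assume m: "Suc m < length ps" and q: "q \<in> pverts T"
    have mem: "ps ! m \<in> set ps" "ps ! Suc m \<in> set ps" using m by auto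
    show "ps ! m \<rightarrow>\<^sup>*\<^bsub>with_proj (del_edge T (ps ! m) (ps ! Suc m))\<^esub> q" if "pos q \<le> m"
    proof (rule ext[OF _ q mem], rule reachable_spine_down)
      show "(ps ! Suc j, ps ! j) \<in> parcs (del_edge T (ps ! m) (ps ! Suc m))" if "Suc j \<le> m" for j
        using that m arc(2)[of j] by (auto simp: del_edge_def inj)
    qed (use m ps(3) that in \<open>auto simp: del_edge_def\<close>)
    show "ps ! Suc m \<rightarrow>\<^sup>*\<^bsub>with_proj (del_edge T (ps ! Suc m) (ps ! m))\<^esub> q" if "m < pos q"
    proof (rule ext[OF _ q mem(2,1)], rule reachable_spine_up)
      show "(ps ! j, ps ! Suc j) \<in> parcs (del_edge T (ps ! Suc m) (ps ! m))"
        if "Suc m \<le> j" "Suc j < length ps" for j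
        using that m arc(1)[of j] by (auto simp: del_edge_def inj)
    qed (use m ps(3) that pos[OF q] in \<open>auto simp: del_edge_def\<close>)
  qed
qed

section \<open>Ordering the vertices along the spine\<close>

lemma layouts_sorted_by:
  fixes P :: "'a \<Rightarrow> nat"
  assumes "finite (pverts G)"
  obtains \<phi> where "\<phi> \<in> layouts G"
    "\<And>u u'. \<lbrakk>u \<in> pverts G; u' \<in> pverts G; \<phi> u \<le> \<phi> u'\<rbrakk> \<Longrightarrow> P u \<le> P u'"
proof -
  obtain xs where xs: "set xs = pverts G" "distinct xs"
    using finite_distinct_list[OF assms] by blast
  define ys where "ys = sort_key P xs"
  have ys: "set ys = pverts G" "distinct ys" "sorted (map P ys)" using xs by (auto simp: ys_def)
  obtain \<phi> where \<phi>: "\<phi> \<in> layouts G" "\<And>j. j < length ys \<Longrightarrow> \<phi> (ys ! j) = Suc j"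
    using layouts_of_list[OF ys(2,1)] by blast
  show thesis
  proof (rule that[OF \<phi>(1)])
    fix u u' assume "u \<in> pverts G" "u' \<in> pverts G" "\<phi> u \<le> \<phi> u'"
    then obtain i j where "i < length ys" "u = ys ! i" "j < length ys" "u' = ys ! j"
      by (metis in_set_conv_nth ys(1))
    then show "P u \<le> P u'" using \<phi>(2) \<open>\<phi> u \<le> \<phi> u'\<close> sorted_nth_mono[OF ys(3), of i j] by simp
  qed
qed

text \<open>Vertices are ordered by the spine position of their leaves. If the i-th vertex has
  position j, the left part consists of vertices before j, which the spine edge from j - 1 to j
  separates from the right part, and of at most four vertices at j. The constant 5 adds these four
  to the class of zero rows.\<close>

lemma (in pair_fin_digraph) d_nw_le_decomposition_width:
  assumes dec: "linear_rank_decomposition G T f" and d: "max_degree G \<le> d"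
  shows "d_nw G \<le> decomposition_width G T f * (d * d) + 5"
proof -
  have cat: "caterpillar T" and deg: "\<And>t. t \<in> pverts T \<Longrightarrow> out_degree T t \<le> 3"
    and f: "bij_betw f (pverts G) (leaves T)"
    using dec by (auto simp: linear_rank_decomposition_def)
  obtain ps pos where finE: "finite (parcs T)"
    and psT: "\<And>j. j < length ps \<Longrightarrow> ps ! j \<in> pverts T"
    and arc: "\<And>j. Suc j < length ps \<Longrightarrow> (ps ! j, ps ! Suc j) \<in> parcs T"
    and pos: "\<And>q. q \<in> pverts T \<Longrightarrow> pos q < length ps"
      "\<And>q. q \<in> pverts T \<Longrightarrow> q = ps ! pos q \<or> (ps ! pos q, q) \<in> parcs T"
    and down: "\<And>m q. \<lbrakk>Suc m < length ps; q \<in> pverts T; pos q \<le> m\<rbrakk> \<Longrightarrow>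
       ps ! m \<rightarrow>\<^sup>*\<^bsub>with_proj (del_edge T (ps ! m) (ps ! Suc m))\<^esub> q"
    and up: "\<And>m q. \<lbrakk>Suc m < length ps; q \<in> pverts T; m < pos q\<rbrakk> \<Longrightarrow>
       ps ! Suc m \<rightarrow>\<^sup>*\<^bsub>with_proj (del_edge T (ps ! Suc m) (ps ! m))\<^esub> q"
    by (fact caterpillar_positions[OF cat])
  have fT: "f x \<in> pverts T" if "x \<in> pverts G" for x
    using bij_betwE[OF f] that by (auto simp: leaves_def)
  define P where "P x = pos (f x)" for x
  obtain \<phi> where \<phi>: "\<phi> \<in> layouts G"
    "\<And>u u'. \<lbrakk>u \<in> pverts G; u' \<in> pverts G; \<phi> u \<le> \<phi> u'\<rbrakk> \<Longrightarrow> P u \<le> P u'"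
    using layouts_sorted_by[OF pair_finite_verts, of P] by blast
  \<comment> \<open>At one position lie at most the spine vertex itself and its at most three
    neighbours.\<close>
  have fibre: "card {x \<in> pverts G. P x = j} \<le> 4" if j: "j < length ps" for j
  proof -
    let ?O = "out_arcs (with_proj T) (ps ! j)"
    have finO: "finite ?O" by (rule finite_subset[OF _ finE]) auto
    have "f ` {x \<in> pverts G. P x = j} \<subseteq> insert (ps ! j) (snd ` ?O)"
      using pos(2) fT by (force simp: P_def)
    then have "card (f ` {x \<in> pverts G. P x = j}) \<le> card (insert (ps ! j) (snd ` ?O))"
      using finO by (intro card_mono) auto
    also have "\<dots> \<le> Suc (card (snd ` ?O))" by (rule card_insert_le_m1) simp_all
    also have "\<dots> \<le> Suc (card ?O)" using finO by (simp add: card_image_le)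
    also have "\<dots> \<le> 4" using deg[OF psT[OF j]] by (simp add: out_degree_def)
    finally have "card (f ` {x \<in> pverts G. P x = j}) \<le> 4" .
    moreover have "inj_on f {x \<in> pverts G. P x = j}"
      using f by (auto simp: bij_betw_def intro: inj_on_subset)
    ultimately show ?thesis by (simp add: card_image)
  qed
  show ?thesis
  proof (rule d_nw_le[OF \<phi>(1)])
    fix i assume "i \<in> {1..card (pverts G)}"
    then obtain u where u: "u \<in> pverts G" "\<phi> u = i" using layout_vertexE[OF \<phi>(1)] by blast
    define j where "j = P u"
    have j: "j < length ps" using pos(1) fT u by (simp add: j_def P_def)
    let ?L = "left_part G i \<phi>" and ?R = "right_part G i \<phi>"
    define A where "A = {x \<in> pverts G. P x < j}"
    have finA: "finite A" using pair_finite_verts by (simp add: A_def)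
    have L: "?L \<subseteq> A \<union> {x \<in> pverts G. P x = j}"
      using \<phi>(2)[of _ u] u by (auto simp: left_part_def A_def j_def le_less)
    have R: "?R \<subseteq> {x \<in> pverts G. j \<le> P x}"
      using \<phi>(2)[of u] u by (auto simp: right_part_def j_def)
    have 1: "card (nbrs_in G ?R ` A) \<le> Suc (decomposition_width G T f * (d * d))"
    proof (cases j)
      case 0
      then show ?thesis by (simp add: A_def)
    next
      case (Suc m)
      let ?A = "edge_side G T f (ps ! m) (ps ! Suc m)" and ?B = "edge_side G T f (ps ! Suc m) (ps ! m)"
      have finA': "finite ?A" using pair_finite_verts by (simp add: edge_side_def)
      have "A \<subseteq> ?A" using down[of m] j fT by (auto simp: A_def edge_side_def Suc P_def)
      moreover have "?R \<subseteq> ?B" using R up[of m] j fT by (auto simp: edge_side_def Suc P_def)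
      ultimately have "card (nbrs_in G ?R ` A) \<le> card (nbrs_in G ?B ` ?A)"
        using finA' by (rule card_nbrs_in_mono)
      also have "\<dots> \<le> Suc (matrix_rank ?A ?B (adj_gf4 G) * (d * d))"
        using finA' d by (rule card_nbrs_in_le_matrix_rank)
      also have "matrix_rank ?A ?B (adj_gf4 G) \<le> decomposition_width G T f"
        unfolding decomposition_width_def
        using cSUP_upper[of "(ps ! m, ps ! Suc m)" "parcs T"
            "\<lambda>(s, t). matrix_rank (edge_side G T f s t) (edge_side G T f t s) (adj_gf4 G)"]
          arc[of m] j finE by (simp add: Suc)
      finally show ?thesis by simp
    qed
    have "nbrs_in G ?R ` ?L \<subseteq> nbrs_in G ?R ` A \<union> nbrs_in G ?R ` {x \<in> pverts G. P x = j}"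
      using L by blast
    then have "card (nbrs_in G ?R ` ?L) \<le>
        card (nbrs_in G ?R ` A \<union> nbrs_in G ?R ` {x \<in> pverts G. P x = j})"
      using finA pair_finite_verts by (intro card_mono) auto
    also have "\<dots> \<le> card (nbrs_in G ?R ` A) + card (nbrs_in G ?R ` {x \<in> pverts G. P x = j})"
      by (rule card_Un_le)
    also have "card (nbrs_in G ?R ` {x \<in> pverts G. P x = j}) \<le> card {x \<in> pverts G. P x = j}"
      using pair_finite_verts by (intro card_image_le) simp
    also have "\<dots> \<le> 4" by (rule fibre[OF j])
    finally show "card (nbrs_in G ?R ` ?L) \<le> decomposition_width G T f * (d * d) + 5"
      using 1 by linarith
  qed
qed

section \<open>Bounds for linear rank-width and equivalence of the four parameters\<close>

lemma d_lrw_bounds: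
  assumes "pair_digraph G" "pverts G \<noteq> {}" "max_degree G \<le> d"
  shows "d_lrw G \<le> d_nw G" "d_nw G \<le> d_lrw G * (d * d) + 5"
proof -
  interpret pair_digraph G by fact
  let ?S = "{(T :: nat pair_pre_digraph, f). linear_rank_decomposition G T f}"
  obtain T :: "nat pair_pre_digraph" and f
    where T: "linear_rank_decomposition G T f" "decomposition_width G T f \<le> d_nw G"
    using linear_rank_decomposition_exists[OF pair_finite_verts assms(2)] by blast
  have "d_lrw G \<le> decomposition_width G T f"
    unfolding d_lrw_def using cINF_lower[of "\<lambda>(T, f). decomposition_width G T f" ?S "(T, f)"] T(1) by simp
  then show "d_lrw G \<le> d_nw G" using T(2) by simp
  have "d_lrw G \<in> (\<lambda>(T, f). decomposition_width G T f) ` ?S"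
    unfolding d_lrw_def by (rule Inf_nat_def1) (use T(1) in auto)
  then obtain T' :: "nat pair_pre_digraph" and f'
    where "linear_rank_decomposition G T' f'" "d_lrw G = decomposition_width G T' f'" by auto
  then show "d_nw G \<le> d_lrw G * (d * d) + 5"
    using d_nw_le_decomposition_width assms(3) by metis
qed

lemma linearly_equivalent_to_d_nw:
  assumes "\<gamma> \<in> {d_nw, d_lnlcw, d_lcw, d_lrw}"
  shows "\<exists>m c. \<forall>G :: 'a pair_pre_digraph. pair_digraph G \<and> max_degree G \<le> d \<longrightarrow>
    \<gamma> G \<le> d_nw G + c \<and> d_nw G \<le> m * \<gamma> G + c"
proof (intro exI allI impI)
  fix G :: "'a pair_pre_digraph"
  let ?E = "\<lparr>pverts = {}, parcs = {}\<rparr> :: 'a pair_pre_digraph"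
  assume G: "pair_digraph G \<and> max_degree G \<le> d"
  then interpret pair_digraph G by blast
  \<comment> \<open>The factor \<open>Suc (d * d)\<close> and the summand 5 cover the bounds for all
    four parameters. The empty digraph has no construction, so the \<open>LEAST\<close> is
    unspecified there; its values are absorbed into the constant, as there is only one empty
    digraph.\<close>
  show "\<gamma> G \<le> d_nw G + (5 + \<gamma> ?E + d_nw ?E) \<and> d_nw G \<le> Suc (d * d) * \<gamma> G + (5 + \<gamma> ?E + d_nw ?E)"
  proof (cases "pverts G = {}")
    case True
    then have "G = ?E" by (auto intro!: pair_pre_digraph.equality dest: in_arcsD1)
    then show ?thesis by simp
  next
    case False
    then show ?thesis
      using assms G d_lnlcw_bounds[of G] d_lcw_bounds[of G] d_lrw_bounds[of G d]
      by (auto simp: algebra_simps)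
  qed
qed

theorem theorem5p8:
  fixes \<G> :: "'a pair_pre_digraph set"
    and \<alpha> \<beta> :: "'a pair_pre_digraph \<Rightarrow> nat"
  assumes "\<And>G. G \<in> \<G> \<Longrightarrow> pair_digraph G"
    and "\<exists>d. \<forall>G \<in> \<G>. max_degree G \<le> d"
    and "\<alpha> \<in> {d_nw, d_lnlcw, d_lcw, d_lrw}"
    and "\<beta> \<in> {d_nw, d_lnlcw, d_lcw, d_lrw}"
  shows "\<exists>f\<^sub>1 f\<^sub>2 :: real poly. \<forall>G \<in> \<G>.
    real (\<alpha> G) \<le> poly f\<^sub>1 (real (\<beta> G)) \<and> real (\<beta> G) \<le> poly f\<^sub>2 (real (\<alpha> G))"
proof -
  obtain d where d: "\<forall>G \<in> \<G>. max_degree G \<le> d" using assms(2) by blast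
  obtain m c where \<alpha>: "\<And>G. G \<in> \<G> \<Longrightarrow> \<alpha> G \<le> d_nw G + c \<and> d_nw G \<le> m * \<alpha> G + c"
    using linearly_equivalent_to_d_nw[OF assms(3), of d] assms(1) d by blast
  obtain m' c' where \<beta>: "\<And>G. G \<in> \<G> \<Longrightarrow> \<beta> G \<le> d_nw G + c' \<and> d_nw G \<le> m' * \<beta> G + c'"
    using linearly_equivalent_to_d_nw[OF assms(4), of d] assms(1) d by blast
  show ?thesis
  proof (intro exI ballI conjI)
    fix G assume G: "G \<in> \<G>"
    \<comment> \<open>The two comparisons are chained through \<open>d_nw\<close>; the resulting
      polynomials are linear.\<close>
    have "\<alpha> G \<le> m' * \<beta> G + (c + c')" "\<beta> G \<le> m * \<alpha> G + (c + c')"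
      using \<alpha>[OF G] \<beta>[OF G] by linarith+
    then have "real (\<alpha> G) \<le> real (m' * \<beta> G + (c + c'))" "real (\<beta> G) \<le> real (m * \<alpha> G + (c + c'))"
      by (simp_all only: of_nat_le_iff)
    then show "real (\<alpha> G) \<le> poly [:real (c + c'), real m':] (real (\<beta> G))"
      "real (\<beta> G) \<le> poly [:real (c + c'), real m:] (real (\<alpha> G))"
      by (simp_all add: algebra_simps)
  qed
qed

end
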